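(* Let $\delta\in(0,1)$. With probability at least $1-\delta$, $$\mathfrak D_{s,\lambda,\gamma}(P,Q)\le\overline{\mathfrak D}_\delta(\gamma)\qquad\text{for every }\gamma\in[0,1].$$ Consequently, for any measurable data-dependent $\widehat\gamma\in[0,1]$ (a measurable function of the samples), $$\mathbb P\left(\overline{\mathfrak D}_\delta(\widehat\gamma)\le0\ \text{ and }\ P\not\preceq_{s,\lambda,\widehat\gamma}^{\rm CSD}Q\right)\le\delta.$$
   Context: Let $D\subseteq\mathbb R^d$ be a nonempty Borel set; $P,Q$ are Borel probability measures supported on $D$ with finite first moments, and moreover supported on known sets $D_P,D_Q\subseteq D$, respectively (i.e. $P(D_P)=Q(D_Q)=1$). $\mathcal C(P,Q)$ is the set of couplings of $P$ and $Q$, and $t_+:=\max\{t,0\}$. Let $(\Theta,\mathscr A,\lambda)$ be a finite measure space and $s:\Theta\times\mathbb R^d\to\mathbb R$ jointly measurable; $s_\theta(x):=s(\theta,x)$. Standing assumptions: each $s_\theta$ is coordinatewise nondecreasing, $\int_\Theta|s_\theta(0)|\,\lambda(d\theta)<\infty$, and for some finite $\overline L_s$, $\int_\Theta|s_\theta(x)-s_\theta(y)|\,\lambda(d\theta)\le\overline L_s\|x-y\|_1$ for all $x,y\in\mathbb R^d$. Define $S(x):=\int_\Theta s_\theta(x)\,\lambda(d\theta)$, $\ell_s(x,y):=\int_\Theta(s_\theta(x)-s_\theta(y))_+\,\lambda(d\theta)$, $L_s^\star(P,Q):=\inf_{\kappa\in\mathcal C(P,Q)}\int\ell_s(x,y)\,\kappa(dx,dy)$,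 and $\mathfrak D_{s,\lambda,\gamma}(P,Q):=\inf_{\kappa\in\mathcal C(P,Q)}\int\{\ell_s(x,y)-\gamma\,\ell_s(y,x)\}\,\kappa(dx,dy)$. CSD: $P\preceq_{s,\lambda,\gamma}^{\rm CSD}Q$ means that there is $\kappa\in\mathcal C(P,Q)$ with $\int\ell_s(x,y)\,\kappa(dx,dy)\le\gamma\int\ell_s(y,x)\,\kappa(dx,dy)$. Samples: $X_1,\ldots,X_{N_P}$ i.i.d. from $P$ and $Y_1,\ldots,Y_{N_Q}$ i.i.d. from $Q$, the two samples independent; $\widehat P_{N_P}:=\frac1{N_P}\sum_i\delta_{X_i}$, $\widehat Q_{N_Q}:=\frac1{N_Q}\sum_j\delta_{Y_j}$, $\widehat\Delta_s:=\frac1{N_Q}\sum_jS(Y_j)-\frac1{N_P}\sum_iS(X_i)$, $\widehat L_s^\star:=L_s^\star(\widehat P_{N_P},\widehat Q_{N_Q})$. Constants, assumed finite: $c_P^L:=\sup_{x,x'\in D_P,\,y\in D_Q}|\ell_s(x,y)-\ell_s(x',y)|$, $c_Q^L:=\sup_{x\in D_P,\,y,y'\in D_Q}|\ell_s(x,y)-\ell_s(x,y')|$, $c_P^S:=\sup_{x,x'\in D_P}|S(x)-S(x')|$, $c_Q^S:=\sup_{y,y'\in D_Q}|S(y)-S(y')|$. Bounds: $$\overline L_\delta:=\widehat L_s^\star+\sqrt{\tfrac{\log(2/\delta)}{2}\Big(\tfrac{(c_P^L)^2}{N_P}+\tfrac{(c_Q^L)^2}{N_Q}\Big)},\qquad\underline\Delta_\delta:=\widehat\Delta_s-\sqrt{\tfrac{\log(2/\delta)}{2}\Big(\tfrac{(c_P^S)^2}{N_P}+\tfrac{(c_Q^S)^2}{N_Q}\Big)},$$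 $$\overline{\mathfrak D}_\delta(\gamma):=(1-\gamma)\overline L_\delta-\gamma\,\underline\Delta_\delta,\quad\gamma\in[0,1].$$ *)

theory Defs
  imports "HOL-Probability.Probability"
begin

definition couplings :: "'a measure \<Rightarrow> 'b measure \<Rightarrow> ('a \<times> 'b) measure set" where
  "couplings P Q = {\<kappa>. sets \<kappa> = sets (P \<Otimes>\<^sub>M Q) \<and> distr \<kappa> P fst = P \<and> distr \<kappa> Q snd = Q}"

definition l1_dist :: "real ^ 'd \<Rightarrow> real ^ 'd \<Rightarrow> real" where
  "l1_dist x y = (\<Sum>i\<in>UNIV. \<bar>x $ i - y $ i\<bar>)"

definition mean_score :: "'t measure \<Rightarrow> ('t \<Rightarrow> 'a \<Rightarrow> real) \<Rightarrow> 'a \<Rightarrow> real" where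
  "mean_score \<Lambda> s x = (\<integral>\<theta>. s \<theta> x \<partial>\<Lambda>)"

definition loss :: "'t measure \<Rightarrow> ('t \<Rightarrow> 'a \<Rightarrow> real) \<Rightarrow> 'a \<Rightarrow> 'a \<Rightarrow> real" where
  "loss \<Lambda> s x y = (\<integral>\<theta>. max (s \<theta> x - s \<theta> y) 0 \<partial>\<Lambda>)"

definition min_loss :: "'t measure \<Rightarrow> ('t \<Rightarrow> 'a \<Rightarrow> real) \<Rightarrow> 'a measure \<Rightarrow> 'a measure \<Rightarrow> real" where
  "min_loss \<Lambda> s P Q = (INF \<kappa>\<in>couplings P Q. \<integral>(x, y). loss \<Lambda> s x y \<partial>\<kappa>)"

definition csd_gap ::
  "'t measure \<Rightarrow> ('t \<Rightarrow> 'a \<Rightarrow> real) \<Rightarrow> real \<Rightarrow> 'a measure \<Rightarrow> 'a measure \<Rightarrow> real" where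
  "csd_gap \<Lambda> s \<gamma> P Q =
     (INF \<kappa>\<in>couplings P Q. \<integral>(x, y). loss \<Lambda> s x y - \<gamma> * loss \<Lambda> s y x \<partial>\<kappa>)"

definition csd ::
  "'t measure \<Rightarrow> ('t \<Rightarrow> 'a \<Rightarrow> real) \<Rightarrow> real \<Rightarrow> 'a measure \<Rightarrow> 'a measure \<Rightarrow> bool" where
  "csd \<Lambda> s \<gamma> P Q \<longleftrightarrow>
     (\<exists>\<kappa>\<in>couplings P Q.
        (\<integral>(x, y). loss \<Lambda> s x y \<partial>\<kappa>) \<le> \<gamma> * (\<integral>(x, y). loss \<Lambda> s y x \<partial>\<kappa>))"

definition empirical :: "nat \<Rightarrow> (nat \<Rightarrow> 'a::topological_space) \<Rightarrow> 'a measure" where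
  "empirical n x = distr (uniform_count_measure {..<n}) borel x"

lemma emeasure_empirical:
  assumes "0 < n" and "A \<in> sets borel"
  shows "emeasure (empirical n x) A = ennreal ((\<Sum>i<n. indicator A (x i)) / real n)"
proof -
  have "emeasure (empirical n x) A = emeasure (uniform_count_measure {..<n}) (x -` A \<inter> {..<n})"
    using assms unfolding empirical_def
    by (subst emeasure_distr) (auto simp: measurable_def space_uniform_count_measure
        sets_uniform_count_measure)
  also have "\<dots> = ennreal (card (x -` A \<inter> {..<n}) / real n)"
    by (subst emeasure_uniform_count_measure) auto
  also have "real (card (x -` A \<inter> {..<n})) = (\<Sum>i<n. indicator A (x i))"
    by (simp add: indicator_def sum.If_cases Int_def vimage_def conj_commute)
  finally show ?thesis .
qed

definition loss_osc_P ::
  "'t measure \<Rightarrow> ('t \<Rightarrow> 'a \<Rightarrow> real) \<Rightarrow> 'a set \<Rightarrow> 'a set \<Rightarrow> real" where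
  "loss_osc_P \<Lambda> s DP DQ =
     (SUP (x, x', y)\<in>DP \<times> DP \<times> DQ. \<bar>loss \<Lambda> s x y - loss \<Lambda> s x' y\<bar>)"

definition loss_osc_Q ::
  "'t measure \<Rightarrow> ('t \<Rightarrow> 'a \<Rightarrow> real) \<Rightarrow> 'a set \<Rightarrow> 'a set \<Rightarrow> real" where
  "loss_osc_Q \<Lambda> s DP DQ =
     (SUP (x, y, y')\<in>DP \<times> DQ \<times> DQ. \<bar>loss \<Lambda> s x y - loss \<Lambda> s x y'\<bar>)"

definition score_osc :: "'t measure \<Rightarrow> ('t \<Rightarrow> 'a \<Rightarrow> real) \<Rightarrow> 'a set \<Rightarrow> real" where
  "score_osc \<Lambda> s A = (SUP (x, x')\<in>A \<times> A. \<bar>mean_score \<Lambda> s x - mean_score \<Lambda> s x'\<bar>)"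

text \<open>In the following, \<open>x\<close> and \<open>y\<close> are realizations of the two samples, of sizes \<open>m\<close> and \<open>n\<close>;
  only the values \<open>x i\<close> with \<open>i < m\<close> and \<open>y j\<close> with \<open>j < n\<close> matter.\<close>

definition emp_diff ::
  "'t measure \<Rightarrow> ('t \<Rightarrow> 'a \<Rightarrow> real) \<Rightarrow> nat \<Rightarrow> nat \<Rightarrow> (nat \<Rightarrow> 'a) \<Rightarrow> (nat \<Rightarrow> 'a) \<Rightarrow> real" where
  "emp_diff \<Lambda> s m n x y =
     (\<Sum>j<n. mean_score \<Lambda> s (y j)) / real n - (\<Sum>i<m. mean_score \<Lambda> s (x i)) / real m"

definition loss_upper ::
  "'t measure \<Rightarrow> ('t \<Rightarrow> 'a::topological_space \<Rightarrow> real) \<Rightarrow> 'a set \<Rightarrow> 'a set \<Rightarrow> real \<Rightarrow>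
    nat \<Rightarrow> nat \<Rightarrow> (nat \<Rightarrow> 'a) \<Rightarrow> (nat \<Rightarrow> 'a) \<Rightarrow> real" where
  "loss_upper \<Lambda> s DP DQ \<delta> m n x y =
     min_loss \<Lambda> s (empirical m x) (empirical n y)
     + sqrt (ln (2 / \<delta>) / 2 *
         ((loss_osc_P \<Lambda> s DP DQ)\<^sup>2 / real m + (loss_osc_Q \<Lambda> s DP DQ)\<^sup>2 / real n))"

definition diff_lower ::
  "'t measure \<Rightarrow> ('t \<Rightarrow> 'a \<Rightarrow> real) \<Rightarrow> 'a set \<Rightarrow> 'a set \<Rightarrow> real \<Rightarrow>
    nat \<Rightarrow> nat \<Rightarrow> (nat \<Rightarrow> 'a) \<Rightarrow> (nat \<Rightarrow> 'a) \<Rightarrow> real" where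
  "diff_lower \<Lambda> s DP DQ \<delta> m n x y =
     emp_diff \<Lambda> s m n x y
     - sqrt (ln (2 / \<delta>) / 2 *
         ((score_osc \<Lambda> s DP)\<^sup>2 / real m + (score_osc \<Lambda> s DQ)\<^sup>2 / real n))"

definition gap_upper ::
  "'t measure \<Rightarrow> ('t \<Rightarrow> 'a::topological_space \<Rightarrow> real) \<Rightarrow> 'a set \<Rightarrow> 'a set \<Rightarrow> real \<Rightarrow>
    nat \<Rightarrow> nat \<Rightarrow> (nat \<Rightarrow> 'a) \<Rightarrow> (nat \<Rightarrow> 'a) \<Rightarrow> real \<Rightarrow> real" where
  "gap_upper \<Lambda> s DP DQ \<delta> m n x y \<gamma> =
     (1 - \<gamma>) * loss_upper \<Lambda> s DP DQ \<delta> m n x y - \<gamma> * diff_lower \<Lambda> s DP DQ \<delta> m n x y"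

end

theory Submission
  imports Defs
begin

text \<open>
  Since \<open>t\<^sub>+ - (- t)\<^sub>+ = t\<close>, every coupling \<open>\<kappa>\<close> satisfies
  \<open>\<integral> \<l>(x, y) - \<gamma> \<l>(y, x) d\<kappa> = (1 - \<gamma>) \<integral> \<l> d\<kappa> - \<gamma> \<Delta>\<close> with \<open>\<Delta> = \<integral> S dQ - \<integral> S dP\<close>. The gap is therefore
  affine in \<open>\<gamma>\<close>, and bounding it for all \<open>\<gamma>\<close> at once amounts to an upper bound on the minimal loss
  and a lower bound on \<open>\<Delta>\<close>. Both come from McDiarmid's inequality, the first one because mixing
  measurably selected near-optimal plans between the empirical measures couples \<open>P\<close> and \<open>Q\<close>,
  so that the minimal loss is at most the expected empirical one.
\<close>

section \<open>McDiarmid's inequality\<close>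

text \<open>Three obstacles shape the proof. CSD asks for a coupling, while the gap is an infimum
  over couplings, so a nonpositive gap does not by itself yield a witness. McDiarmid's tail bound
  also covers deviations exactly at the threshold; this makes the loss bound strict, hence the gap
  negative for \<gamma> < 1, and some coupling undercuts 0. At \<gamma> = 1 all couplings give the
  same value. Next, the oscillation constants speak only about \<open>DP\<close> and
  \<open>DQ\<close>, which the samples hit almost surely, whereas McDiarmid's inequality asks for
  bounded differences everywhere; stray coordinates are therefore moved to fixed points inside.
  Finally, a near-optimal plan varies with the data, so measurability of the empirical cost and
  selection of plans both rest on one countable family of plans that serves every cost matrix. The 2
  in \<open>ln (2 / \<delta>)\<close> comes from giving half of \<delta> to the loss and half to
  \<Delta>; neither of these two events mentions \<gamma>, which is why \<gamma> may depend on the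
  data.\<close>

lemma (in prob_space) abs_expectation_diff_le:
  fixes u v :: "'a \<Rightarrow> real"
  assumes "integrable M u" "integrable M v" "\<And>x. x \<in> space M \<Longrightarrow> \<bar>u x - v x\<bar> \<le> c"
  shows "\<bar>expectation u - expectation v\<bar> \<le> c"
proof -
  have "expectation u - expectation v = expectation (\<lambda>x. u x - v x)"
    using assms by simp
  also have "\<bar>\<dots>\<bar> \<le> expectation (\<lambda>x. \<bar>u x - v x\<bar>)"
    by (rule integral_abs_bound)
  also have "\<dots> \<le> c"
    using assms by (intro integral_le_const) auto
  finally show ?thesis .
qed

text \<open>With \<open>g\<close> the average of \<open>f\<close> over the first factor,
  \<open>f - e\<close> splits into \<open>f - g\<close> and \<open>g - e\<close>. The second part is
  constant on each fibre and leaves the inner integral, so the exponents \<open>u\<close> and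
  \<open>v\<close> add. This is how moment bounds pass to product measures; boundedness of
  \<open>f\<close> justifies Fubini for \<open>e\<close>.\<close>

lemma mgf_pair_measure:
  fixes f :: "'a \<times> 'b \<Rightarrow> real"
  assumes "prob_space A" "prob_space B"
    and f [measurable]: "f \<in> borel_measurable (A \<Otimes>\<^sub>M B)"
    and bound: "\<And>z. z \<in> space (A \<Otimes>\<^sub>M B) \<Longrightarrow> \<bar>f z\<bar> \<le> C"
    and inner: "\<And>b. b \<in> space B \<Longrightarrow>
      (\<integral>\<^sup>+a. exp (t * (f (a, b) - (\<integral>a'. f (a', b) \<partial>A))) \<partial>A) \<le> ennreal (exp u)"
    and outer: "(\<integral>\<^sup>+b. exp (t * ((\<integral>a. f (a, b) \<partial>A) - (\<integral>b'. (\<integral>a. f (a, b') \<partial>A) \<partial>B))) \<partial>B)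
      \<le> ennreal (exp v)"
  shows "(\<integral>\<^sup>+z. exp (t * (f z - (\<integral>z'. f z' \<partial>(A \<Otimes>\<^sub>M B)))) \<partial>(A \<Otimes>\<^sub>M B)) \<le> ennreal (exp (u + v))"
proof -
  interpret A: prob_space A by fact
  interpret B: prob_space B by fact
  interpret AB: pair_prob_space A B ..
  have int: "integrable (A \<Otimes>\<^sub>M B) f"
    using bound by (intro AB.P.integrable_const_bound[of _ C]) auto
  define g where "g b = (\<integral>a. f (a, b) \<partial>A)" for b
  define e where "e = (\<integral>b. g b \<partial>B)"
  have g [measurable]: "g \<in> borel_measurable B"
    unfolding g_def by (rule A.borel_measurable_lebesgue_integral) simp
  have e: "e = (\<integral>z. f z \<partial>(A \<Otimes>\<^sub>M B))"
    using AB.integral_snd[of "\<lambda>a b. f (a, b)"] int by (simp add: e_def g_def)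
  have "(\<integral>\<^sup>+z. exp (t * (f z - e)) \<partial>(A \<Otimes>\<^sub>M B)) =
      (\<integral>\<^sup>+b. \<integral>\<^sup>+a. exp (t * (f (a, b) - e)) \<partial>A \<partial>B)"
    by (subst AB.nn_integral_snd[symmetric]) auto
  also have "\<dots> = (\<integral>\<^sup>+b. \<integral>\<^sup>+a. ennreal (exp (t * (g b - e))) * exp (t * (f (a, b) - g b)) \<partial>A \<partial>B)"
    by (simp add: ennreal_mult[symmetric] exp_add[symmetric] algebra_simps)
  also have "\<dots> \<le> (\<integral>\<^sup>+b. ennreal (exp (t * (g b - e))) * exp u \<partial>B)"
  proof (rule nn_integral_mono)
    fix b assume b: "b \<in> space B"
    have "(\<integral>\<^sup>+a. ennreal (exp (t * (g b - e))) * exp (t * (f (a, b) - g b)) \<partial>A) =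
        ennreal (exp (t * (g b - e))) * (\<integral>\<^sup>+a. exp (t * (f (a, b) - g b)) \<partial>A)"
      using b by (intro nn_integral_cmult) simp
    also have "\<dots> \<le> ennreal (exp (t * (g b - e))) * exp u"
      using inner[OF b] by (intro mult_left_mono) (auto simp: g_def)
    finally show "(\<integral>\<^sup>+a. ennreal (exp (t * (g b - e))) * exp (t * (f (a, b) - g b)) \<partial>A)
      \<le> ennreal (exp (t * (g b - e))) * exp u" .
  qed
  also have "\<dots> = (\<integral>\<^sup>+b. exp (t * (g b - e)) \<partial>B) * exp u"
    by (intro nn_integral_multc) simp
  also have "\<dots> \<le> ennreal (exp v) * exp u"
    using outer by (intro mult_right_mono) (auto simp: g_def e_def)
  also have "\<dots> = exp (u + v)"
    by (simp add: ennreal_mult[symmetric] exp_add[symmetric] add.commute)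
  finally show ?thesis by (simp add: e)
qed

text \<open>An oscillation of at most \<open>c\<close> places all values in
  \<open>{a..a + c}\<close> with \<open>a\<close> the infimum, and Hoeffding's lemma sees only the
  length \<open>c\<close> of that interval.\<close>

lemma (in prob_space) Hoeffdings_lemma_osc:
  fixes f :: "'a \<Rightarrow> real"
  assumes [measurable]: "f \<in> borel_measurable M" and t: "0 < t"
    and osc: "\<And>x y. x \<in> space M \<Longrightarrow> y \<in> space M \<Longrightarrow> \<bar>f x - f y\<bar> \<le> c"
  shows "(\<integral>\<^sup>+x. exp (t * (f x - expectation f)) \<partial>M) \<le> ennreal (exp (t\<^sup>2 * c\<^sup>2 / 8))"
proof -
  obtain x0 where x0: "x0 \<in> space M" using not_empty by blast
  have c: "0 \<le> c" using osc[OF x0 x0] by simp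
  define a where "a = (INF x\<in>space M. f x)"
  have bdd: "bdd_below (f ` space M)"
    by (rule bdd_belowI2[of _ "f x0 - c"]) (use osc[OF x0] in \<open>fastforce simp: abs_le_iff\<close>)
  have "f x \<in> {a..a + c}" if x: "x \<in> space M" for x
  proof -
    have "f x - c \<le> a"
      unfolding a_def by (rule cINF_greatest) (use osc[OF x] x0 in \<open>auto simp: abs_le_iff algebra_simps\<close>)
    thus ?thesis using cINF_lower[OF bdd x] by (simp add: a_def)
  qed
  then interpret interval_bounded_random_variable M f a "a + c"
    by unfold_locales auto
  show ?thesis using Hoeffdings_lemma_nn_integral[OF t] by simp
qed

text \<open>Coordinate \<open>i\<close> is split off as an independent factor. Hoeffding's lemma on
  each fibre contributes the square of \<open>c i\<close>; the average over coordinate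
  \<open>i\<close> is a function of the remaining coordinates that inherits their difference bounds,
  so the induction hypothesis applies to it. This is why \<open>f\<close> is generalised in the
  induction.\<close>

lemma mgf_bounded_differences:
  fixes M :: "'i \<Rightarrow> 'a measure" and f :: "('i \<Rightarrow> 'a) \<Rightarrow> real"
  assumes "finite I" and M: "\<And>i. prob_space (M i)" and t: "0 < t"
    and "f \<in> borel_measurable (PiM I M)"
    and "\<And>x. x \<in> space (PiM I M) \<Longrightarrow> \<bar>f x\<bar> \<le> C"
    and "\<And>x i a. x \<in> space (PiM I M) \<Longrightarrow> i \<in> I \<Longrightarrow> a \<in> space (M i) \<Longrightarrow> \<bar>f (x(i := a)) - f x\<bar> \<le> c i"
  shows "(\<integral>\<^sup>+x. exp (t * (f x - (\<integral>x. f x \<partial>PiM I M))) \<partial>PiM I M)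
    \<le> ennreal (exp (t\<^sup>2 * (\<Sum>i\<in>I. (c i)\<^sup>2) / 8))"
  using assms(1,4-)
proof (induction I arbitrary: f)
  case empty
  interpret prob_space "PiM {} M" by (intro prob_space_PiM M)
  show ?case
    by (simp add: PiM_empty nn_integral_count_space_finite lebesgue_integral_count_space_finite)
next
  case (insert i I)
  interpret PI: prob_space "PiM I M" by (intro prob_space_PiM M)
  interpret Mi: prob_space "M i" by (rule M)
  interpret AB: pair_prob_space "M i" "PiM I M" ..
  note [measurable] = insert.prems(1)
  let ?N = "M i \<Otimes>\<^sub>M PiM I M" and ?J = "PiM (insert i I) M"
  define h where "h = (\<lambda>(a, x). f (x(i := a)))"
  have ins [measurable]: "(\<lambda>(a, x). x(i := a)) \<in> ?N \<rightarrow>\<^sub>M ?J"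
    by simp
  have h [measurable]: "h \<in> borel_measurable ?N"
    unfolding h_def using measurable_comp[OF ins insert.prems(1)] by (simp add: comp_def split_beta)
  have J: "distr ?N ?J (\<lambda>(a, x). x(i := a)) = ?J"
    by (rule distr_pair_PiM_eq_PiM) (auto intro: M)
  have upd: "x(i := a) \<in> space ?J" if "x \<in> space (PiM I M)" "a \<in> space (M i)" for x a
    using that by (auto simp: space_PiM PiE_def extensional_def)
  have hC: "\<bar>h z\<bar> \<le> C" if "z \<in> space ?N" for z
    using that by (auto simp: h_def space_pair_measure intro!: insert.prems(2) upd)
  have hint: "integrable (M i) (\<lambda>a. h (a, x))" if "x \<in> space (PiM I M)" for x
    using that hC by (intro Mi.integrable_const_bound[of _ C]) (auto simp: space_pair_measure)
  have "(\<integral>\<^sup>+z. exp (t * (h z - (\<integral>z'. h z' \<partial>?N))) \<partial>?N)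
      \<le> ennreal (exp (t\<^sup>2 * (c i)\<^sup>2 / 8 + t\<^sup>2 * (\<Sum>i\<in>I. (c i)\<^sup>2) / 8))"
  proof (rule mgf_pair_measure)
    fix x assume x: "x \<in> space (PiM I M)"
    show "(\<integral>\<^sup>+a. exp (t * (h (a, x) - (\<integral>a'. h (a', x) \<partial>M i))) \<partial>M i) \<le> ennreal (exp (t\<^sup>2 * (c i)\<^sup>2 / 8))"
    proof (rule Mi.Hoeffdings_lemma_osc)
      fix a b assume a: "a \<in> space (M i)" and b: "b \<in> space (M i)"
      have "\<bar>f ((x(i := b))(i := a)) - f (x(i := b))\<bar> \<le> c i"
        by (rule insert.prems(3)[OF upd[OF x b] _ a]) simp
      thus "\<bar>h (a, x) - h (b, x)\<bar> \<le> c i"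
        by (simp only: h_def prod.case fun_upd_upd)
    qed (use t x in auto)
  next
    show "(\<integral>\<^sup>+x. exp (t * ((\<integral>a. h (a, x) \<partial>M i) - (\<integral>x'. (\<integral>a. h (a, x') \<partial>M i) \<partial>PiM I M))) \<partial>PiM I M)
      \<le> ennreal (exp (t\<^sup>2 * (\<Sum>i\<in>I. (c i)\<^sup>2) / 8))"
    proof (rule insert.IH)
      show "(\<lambda>x. \<integral>a. h (a, x) \<partial>M i) \<in> borel_measurable (PiM I M)"
        by (rule Mi.borel_measurable_lebesgue_integral) simp
    next
      fix x assume x: "x \<in> space (PiM I M)"
      show "\<bar>\<integral>a. h (a, x) \<partial>M i\<bar> \<le> C"
        using Mi.abs_expectation_diff_le[OF hint[OF x], of "\<lambda>_. 0" C] hC x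
        by (auto simp: space_pair_measure)
    next
      fix x j b assume x: "x \<in> space (PiM I M)" and j: "j \<in> I" and b: "b \<in> space (M j)"
      have x': "x(j := b) \<in> space (PiM I M)"
        using x j b by (auto simp: space_PiM PiE_def extensional_def)
      show "\<bar>(\<integral>a. h (a, x(j := b)) \<partial>M i) - (\<integral>a. h (a, x) \<partial>M i)\<bar> \<le> c j"
      proof (rule Mi.abs_expectation_diff_le[OF hint[OF x'] hint[OF x]])
        fix a assume a: "a \<in> space (M i)"
        have "(x(j := b))(i := a) = (x(i := a))(j := b)"
          using j insert.hyps by (auto simp: fun_eq_iff)
        moreover have "\<bar>f ((x(i := a))(j := b)) - f (x(i := a))\<bar> \<le> c j"
          by (rule insert.prems(3)[OF upd[OF x a] _ b]) (simp add: j)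
        ultimately show "\<bar>h (a, x(j := b)) - h (a, x)\<bar> \<le> c j"
          by (simp only: h_def prod.case)
      qed
    qed
  qed (use hC Mi.prob_space_axioms PI.prob_space_axioms in auto)
  also have "(\<integral>z. h z \<partial>?N) = (\<integral>x. f x \<partial>?J)"
    by (subst J[symmetric], subst integral_distr) (auto simp: h_def case_prod_beta')
  also have "(\<integral>\<^sup>+z. exp (t * (h z - (\<integral>x. f x \<partial>?J))) \<partial>?N) = (\<integral>\<^sup>+x. exp (t * (f x - (\<integral>x. f x \<partial>?J))) \<partial>?J)"
    by (subst (2) J[symmetric], subst nn_integral_distr) (auto simp: h_def case_prod_beta')
  finally show ?case
    using insert.hyps by (simp add: algebra_simps add_divide_distrib)
qed

text \<open>The two blocks of coordinates are the two factors of \<open>mgf_pair_measure\<close>,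
  and averaging out the first block preserves the bounds \<open>d\<close> for the second. Keeping
  the blocks apart matches the law of a pair of independent samples.\<close>

lemma mgf_bounded_differences_pair:
  fixes A :: "'i \<Rightarrow> 'a measure" and B :: "'j \<Rightarrow> 'b measure"
    and I :: "'i set" and J :: "'j set" and f :: "('i \<Rightarrow> 'a) \<times> ('j \<Rightarrow> 'b) \<Rightarrow> real"
  defines "N \<equiv> PiM I A \<Otimes>\<^sub>M PiM J B"
  assumes "finite I" "finite J" and A: "\<And>i. prob_space (A i)" and B: "\<And>j. prob_space (B j)"
    and t: "0 < t" and f: "f \<in> borel_measurable N"
    and C: "\<And>z. z \<in> space N \<Longrightarrow> \<bar>f z\<bar> \<le> C"
    and c: "\<And>x y i a. (x, y) \<in> space N \<Longrightarrow> i \<in> I \<Longrightarrow> a \<in> space (A i) \<Longrightarrow>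
      \<bar>f (x(i := a), y) - f (x, y)\<bar> \<le> c i"
    and d: "\<And>x y j b. (x, y) \<in> space N \<Longrightarrow> j \<in> J \<Longrightarrow> b \<in> space (B j) \<Longrightarrow>
      \<bar>f (x, y(j := b)) - f (x, y)\<bar> \<le> d j"
  shows "(\<integral>\<^sup>+z. exp (t * (f z - (\<integral>z. f z \<partial>N))) \<partial>N)
    \<le> ennreal (exp (t\<^sup>2 * ((\<Sum>i\<in>I. (c i)\<^sup>2) + (\<Sum>j\<in>J. (d j)\<^sup>2)) / 8))"
proof -
  interpret PA: prob_space "PiM I A" by (intro prob_space_PiM A)
  interpret PB: prob_space "PiM J B" by (intro prob_space_PiM B)
  have [measurable]: "f \<in> borel_measurable (PiM I A \<Otimes>\<^sub>M PiM J B)"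
    using f by (simp add: N_def)
  have sp: "(x, y) \<in> space N \<longleftrightarrow> x \<in> space (PiM I A) \<and> y \<in> space (PiM J B)" for x y
    by (auto simp: N_def space_pair_measure)
  have int: "integrable (PiM I A) (\<lambda>x. f (x, y))" if "y \<in> space (PiM J B)" for y
    using that C by (intro PA.integrable_const_bound[of _ C]) (auto simp: sp)
  have "(\<integral>\<^sup>+z. exp (t * (f z - (\<integral>z. f z \<partial>N))) \<partial>N)
    \<le> ennreal (exp (t\<^sup>2 * (\<Sum>i\<in>I. (c i)\<^sup>2) / 8 + t\<^sup>2 * (\<Sum>j\<in>J. (d j)\<^sup>2) / 8))"
    unfolding N_def
  proof (rule mgf_pair_measure)
    fix y assume y: "y \<in> space (PiM J B)"
    show "(\<integral>\<^sup>+x. exp (t * (f (x, y) - (\<integral>x'. f (x', y) \<partial>PiM I A))) \<partial>PiM I A)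
        \<le> ennreal (exp (t\<^sup>2 * (\<Sum>i\<in>I. (c i)\<^sup>2) / 8))"
      using y C c by (intro mgf_bounded_differences[where C = C] A t \<open>finite I\<close>) (auto simp: sp)
  next
    show "(\<integral>\<^sup>+y. exp (t * ((\<integral>x. f (x, y) \<partial>PiM I A) -
        (\<integral>y'. (\<integral>x. f (x, y') \<partial>PiM I A) \<partial>PiM J B))) \<partial>PiM J B)
      \<le> ennreal (exp (t\<^sup>2 * (\<Sum>j\<in>J. (d j)\<^sup>2) / 8))"
    proof (rule mgf_bounded_differences)
      show "(\<lambda>y. \<integral>x. f (x, y) \<partial>PiM I A) \<in> borel_measurable (PiM J B)"
        by (rule PA.borel_measurable_lebesgue_integral) simp
    next
      fix y assume y: "y \<in> space (PiM J B)"
      show "\<bar>\<integral>x. f (x, y) \<partial>PiM I A\<bar> \<le> C"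
        using PA.abs_expectation_diff_le[OF int[OF y], of "\<lambda>_. 0" C] C y by (auto simp: sp)
    next
      fix y j b assume y: "y \<in> space (PiM J B)" and j: "j \<in> J" and b: "b \<in> space (B j)"
      have y': "y(j := b) \<in> space (PiM J B)"
        using y j b by (auto simp: space_PiM PiE_def extensional_def)
      show "\<bar>(\<integral>x. f (x, y(j := b)) \<partial>PiM I A) - (\<integral>x. f (x, y) \<partial>PiM I A)\<bar> \<le> d j"
        using d j b y by (intro PA.abs_expectation_diff_le[OF int[OF y'] int[OF y]]) (auto simp: sp)
    qed (use t B \<open>finite J\<close> in auto)
  qed (use C PA.prob_space_axioms PB.prob_space_axioms in \<open>auto simp: N_def\<close>)
  thus ?thesis by (simp add: algebra_simps add_divide_distrib)
qed

lemma mcdiarmid_pair: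
  fixes A :: "'i \<Rightarrow> 'a measure" and B :: "'j \<Rightarrow> 'b measure"
    and I :: "'i set" and J :: "'j set" and f :: "('i \<Rightarrow> 'a) \<times> ('j \<Rightarrow> 'b) \<Rightarrow> real"
  defines "N \<equiv> PiM I A \<Otimes>\<^sub>M PiM J B"
  assumes fin: "finite I" "finite J" and A: "\<And>i. prob_space (A i)" and B: "\<And>j. prob_space (B j)"
    and f: "f \<in> borel_measurable N"
    and C: "\<And>z. z \<in> space N \<Longrightarrow> \<bar>f z\<bar> \<le> C"
    and c: "\<And>x y i a. (x, y) \<in> space N \<Longrightarrow> i \<in> I \<Longrightarrow> a \<in> space (A i) \<Longrightarrow>
      \<bar>f (x(i := a), y) - f (x, y)\<bar> \<le> c i"
    and d: "\<And>x y j b. (x, y) \<in> space N \<Longrightarrow> j \<in> J \<Longrightarrow> b \<in> space (B j) \<Longrightarrow>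
      \<bar>f (x, y(j := b)) - f (x, y)\<bar> \<le> d j"
    and V: "V = (\<Sum>i\<in>I. (c i)\<^sup>2) + (\<Sum>j\<in>J. (d j)\<^sup>2)" "0 < V" and \<epsilon>: "0 < \<epsilon>"
  shows "measure N {z \<in> space N. f z \<ge> (\<integral>z. f z \<partial>N) + \<epsilon>} \<le> exp (- 2 * \<epsilon>\<^sup>2 / V)"
proof -
  interpret PA: prob_space "PiM I A" by (intro prob_space_PiM A)
  interpret PB: prob_space "PiM J B" by (intro prob_space_PiM B)
  interpret pair_prob_space "PiM I A" "PiM J B" ..
  interpret N: prob_space N unfolding N_def by (rule P.prob_space_axioms)
  note [measurable] = f
  define e where "e = (\<integral>z. f z \<partial>N)"
  \<comment> \<open>The exponent \<open>- t * \<epsilon> + t\<^sup>2 * V / 8\<close> is minimal at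
    this \<open>t\<close>, with minimum \<open>- 2 * \<epsilon>\<^sup>2 / V\<close>.\<close>
  define t where "t = 4 * \<epsilon> / V"
  have t: "0 < t" using V \<epsilon> by (simp add: t_def)
  have "ennreal (measure N {z \<in> space N. f z \<ge> e + \<epsilon>}) = emeasure N {z \<in> space N. f z - e \<ge> \<epsilon>}"
    by (simp add: N.emeasure_eq_measure algebra_simps)
  also have "\<dots> \<le> ennreal (exp (- t * \<epsilon>)) * (\<integral>\<^sup>+z\<in>space N. exp (t * (f z - e)) \<partial>N)"
    by (intro Chernoff_ineq_nn_integral_ge t) auto
  also have "(\<integral>\<^sup>+z\<in>space N. exp (t * (f z - e)) \<partial>N) = (\<integral>\<^sup>+z. exp (t * (f z - e)) \<partial>N)"
    by (intro nn_integral_cong) simp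
  also have "ennreal (exp (- t * \<epsilon>)) * \<dots> \<le> ennreal (exp (- t * \<epsilon>)) * ennreal (exp (t\<^sup>2 * V / 8))"
    unfolding V(1) e_def N_def
    by (intro mult_left_mono mgf_bounded_differences_pair fin A B t)
      (use f C c d in \<open>auto simp: N_def\<close>)
  also have "\<dots> = exp (- t * \<epsilon> + t\<^sup>2 * V / 8)"
    by (simp add: ennreal_mult[symmetric] exp_add[symmetric])
  also have "- t * \<epsilon> + t\<^sup>2 * V / 8 = - 2 * \<epsilon>\<^sup>2 / V"
    using V(2) by (simp add: t_def field_simps power2_eq_square)
  finally show ?thesis
    by (subst (asm) ennreal_le_iff) (simp_all add: e_def)
qed

section \<open>Couplings and scores\<close>

lemma (in prob_space) distr_pair_snd:
  assumes "sigma_finite_measure N"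
  shows "distr (M \<Otimes>\<^sub>M N) N snd = N"
proof (rule measure_eqI)
  interpret N: sigma_finite_measure N by fact
  fix A assume "A \<in> sets (distr (M \<Otimes>\<^sub>M N) N snd)"
  hence A: "A \<in> sets N" by simp
  hence "snd -` A \<inter> space (M \<Otimes>\<^sub>M N) = space M \<times> A"
    by (auto simp: space_pair_measure dest: sets.sets_into_space)
  with A show "emeasure (distr (M \<Otimes>\<^sub>M N) N snd) A = emeasure N A"
    by (simp add: emeasure_distr N.emeasure_pair_measure_Times emeasure_space_1)
qed simp

lemma pair_measure_in_couplings:
  assumes "prob_space P" "prob_space Q"
  shows "P \<Otimes>\<^sub>M Q \<in> couplings P Q"
proof -
  interpret P: prob_space P by fact
  interpret Q: prob_space Q by fact
  show ?thesis
    by (simp add: couplings_def Q.distr_pair_fst P.distr_pair_snd Q.sigma_finite_measure_axioms)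
qed

locale coupling = P: prob_space P + Q: prob_space Q for P :: "'a measure" and Q :: "'b measure" +
  fixes \<kappa> :: "('a \<times> 'b) measure"
  assumes in_couplings: "\<kappa> \<in> couplings P Q"
begin

lemma sets_eq [measurable_cong]: "sets \<kappa> = sets (P \<Otimes>\<^sub>M Q)"
  and distr_fst: "distr \<kappa> P fst = P" and distr_snd: "distr \<kappa> Q snd = Q"
  using in_couplings by (auto simp: couplings_def)

text \<open>\<open>couplings\<close> fixes only the measurable sets and the marginals; total mass 1
  is inherited from \<open>P\<close>, since pushing forward along \<open>fst\<close> preserves
  it.\<close>

sublocale prob_space \<kappa>
proof (rule prob_space_distrD)
  show "fst \<in> \<kappa> \<rightarrow>\<^sub>M P" by measurable
  show "prob_space (distr \<kappa> P fst)"
    using P.prob_space_axioms by (simp add: distr_fst)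
qed

lemma AE_fst: "AE x in P. R x \<Longrightarrow> AE z in \<kappa>. R (fst z)"
  using AE_distrD[of fst \<kappa> P R] unfolding distr_fst by simp

lemma AE_snd: "AE y in Q. R y \<Longrightarrow> AE z in \<kappa>. R (snd z)"
  using AE_distrD[of snd \<kappa> Q R] unfolding distr_snd by simp

lemma integrable_fst: "integrable P (f :: _ \<Rightarrow> real) \<Longrightarrow> integrable \<kappa> (\<lambda>z. f (fst z))"
  by (rule integrable_distr[where M' = P]) (auto simp: distr_fst)

lemma integrable_snd: "integrable Q (f :: _ \<Rightarrow> real) \<Longrightarrow> integrable \<kappa> (\<lambda>z. f (snd z))"
  by (rule integrable_distr[where M' = Q]) (auto simp: distr_snd)

lemma integral_fst:
  fixes f :: "'a \<Rightarrow> real"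
  assumes "f \<in> borel_measurable P"
  shows "(\<integral>z. f (fst z) \<partial>\<kappa>) = (\<integral>x. f x \<partial>P)"
  using integral_distr[of fst \<kappa> P f] assms by (simp add: distr_fst)

lemma integral_snd:
  fixes f :: "'b \<Rightarrow> real"
  assumes "f \<in> borel_measurable Q"
  shows "(\<integral>z. f (snd z) \<partial>\<kappa>) = (\<integral>y. f y \<partial>Q)"
  using integral_distr[of snd \<kappa> Q f] assms by (simp add: distr_snd)

end

lemma l1_dist_nonneg: "0 \<le> l1_dist x y"
  by (simp add: l1_dist_def sum_nonneg)

text \<open>The score is Lipschitz in the l1 distance, while moments and continuity are measured in
  the Euclidean norm; this inequality links the two.\<close>

lemma l1_dist_le_norm:
  fixes x y :: "real ^ 'd"
  shows "l1_dist x y \<le> CARD('d) * norm (x - y)"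
proof -
  have "l1_dist x y \<le> (\<Sum>i\<in>(UNIV :: 'd set). norm (x - y))"
    unfolding l1_dist_def using component_le_norm_cart[of "x - y"] by (intro sum_mono) simp
  thus ?thesis by simp
qed

section \<open>Lipschitz scores, their mean and their loss\<close>

locale lipschitz_score =
  fixes \<Lambda> :: "'t measure" and s :: "'t \<Rightarrow> real ^ 'd \<Rightarrow> real" and L :: real
  assumes s_measurable: "(\<lambda>(\<theta>, x). s \<theta> x) \<in> borel_measurable (\<Lambda> \<Otimes>\<^sub>M borel)"
    and s_0: "(\<integral>\<^sup>+\<theta>. ennreal \<bar>s \<theta> 0\<bar> \<partial>\<Lambda>) < \<infinity>"
    and L_nonneg: "0 \<le> L"
    and s_lipschitz:
      "\<And>x y. (\<integral>\<^sup>+\<theta>. ennreal \<bar>s \<theta> x - s \<theta> y\<bar> \<partial>\<Lambda>) \<le> ennreal (L * l1_dist x y)"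
begin

abbreviation "S \<equiv> mean_score \<Lambda> s"
abbreviation "\<l> \<equiv> loss \<Lambda> s"

lemma s_section_measurable [measurable]: "(\<lambda>\<theta>. s \<theta> x) \<in> borel_measurable \<Lambda>"
  using measurable_compose[OF _ s_measurable, of "\<lambda>\<theta>. (\<theta>, x)"] by simp

lemma integrable_s_diff: "integrable \<Lambda> (\<lambda>\<theta>. s \<theta> x - s \<theta> y)"
  unfolding integrable_iff_bounded
  using le_less_trans[OF s_lipschitz[of x y] ennreal_less_top] by simp

lemma integrable_s: "integrable \<Lambda> (\<lambda>\<theta>. s \<theta> x)"
proof -
  have "integrable \<Lambda> (\<lambda>\<theta>. s \<theta> 0)"
    unfolding integrable_iff_bounded using s_0 by simp
  from Bochner_Integration.integrable_add[OF integrable_s_diff[of x 0] this] show ?thesis by simp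
qed

lemma integral_abs_s_diff_le: "(\<integral>\<theta>. \<bar>s \<theta> x - s \<theta> y\<bar> \<partial>\<Lambda>) \<le> L * l1_dist x y"
proof -
  have "ennreal (\<integral>\<theta>. \<bar>s \<theta> x - s \<theta> y\<bar> \<partial>\<Lambda>) = (\<integral>\<^sup>+\<theta>. ennreal \<bar>s \<theta> x - s \<theta> y\<bar> \<partial>\<Lambda>)"
    by (intro nn_integral_eq_integral[symmetric] integrable_abs integrable_s_diff) simp
  also have "\<dots> \<le> ennreal (L * l1_dist x y)" by (rule s_lipschitz)
  finally show ?thesis
    using L_nonneg l1_dist_nonneg[of x y] by (subst (asm) ennreal_le_iff) auto
qed

lemma integrable_loss_integrand: "integrable \<Lambda> (\<lambda>\<theta>. max (s \<theta> x - s \<theta> y) 0)"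
  by (rule Bochner_Integration.integrable_bound[OF integrable_s_diff[of x y]]) auto

lemma loss_nonneg: "0 \<le> \<l> x y"
  by (simp add: loss_def)

lemma loss_diff_swap: "\<l> x y - \<l> y x = S x - S y"
proof -
  have "\<l> x y - \<l> y x = (\<integral>\<theta>. max (s \<theta> x - s \<theta> y) 0 - max (s \<theta> y - s \<theta> x) 0 \<partial>\<Lambda>)"
    by (simp add: loss_def integrable_loss_integrand)
  also have "\<dots> = (\<integral>\<theta>. s \<theta> x - s \<theta> y \<partial>\<Lambda>)"
    by (rule Bochner_Integration.integral_cong) auto
  also have "\<dots> = S x - S y"
    by (simp add: mean_score_def integrable_s)
  finally show ?thesis .
qed

lemma abs_mean_score_diff_le: "\<bar>S x - S y\<bar> \<le> L * l1_dist x y"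
proof -
  have "\<bar>S x - S y\<bar> = \<bar>\<integral>\<theta>. s \<theta> x - s \<theta> y \<partial>\<Lambda>\<bar>"
    by (simp add: mean_score_def integrable_s)
  also have "\<dots> \<le> (\<integral>\<theta>. \<bar>s \<theta> x - s \<theta> y\<bar> \<partial>\<Lambda>)"
    by (rule integral_abs_bound)
  finally show ?thesis using integral_abs_s_diff_le[of x y] by linarith
qed

text \<open>The positive part is 1-Lipschitz, so for each \<theta> the integrands differ by at most
  \<open>\<bar>s \<theta> x - s \<theta> x'\<bar> + \<bar>s \<theta> y - s \<theta>
  y'\<bar>\<close>.\<close>

lemma abs_loss_diff_le: "\<bar>\<l> x y - \<l> x' y'\<bar> \<le> L * l1_dist x x' + L * l1_dist y y'"
proof -
  have "\<bar>\<l> x y - \<l> x' y'\<bar> = \<bar>\<integral>\<theta>. max (s \<theta> x - s \<theta> y) 0 - max (s \<theta> x' - s \<theta> y') 0 \<partial>\<Lambda>\<bar>"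
    by (simp add: loss_def integrable_loss_integrand)
  also have "\<dots> \<le> (\<integral>\<theta>. \<bar>max (s \<theta> x - s \<theta> y) 0 - max (s \<theta> x' - s \<theta> y') 0\<bar> \<partial>\<Lambda>)"
    by (rule integral_abs_bound)
  also have "\<dots> \<le> (\<integral>\<theta>. \<bar>s \<theta> x - s \<theta> x'\<bar> + \<bar>s \<theta> y - s \<theta> y'\<bar> \<partial>\<Lambda>)"
    by (intro integral_mono integrable_abs Bochner_Integration.integrable_add
        Bochner_Integration.integrable_diff integrable_loss_integrand integrable_s) auto
  also have "\<dots> = (\<integral>\<theta>. \<bar>s \<theta> x - s \<theta> x'\<bar> \<partial>\<Lambda>) + (\<integral>\<theta>. \<bar>s \<theta> y - s \<theta> y'\<bar> \<partial>\<Lambda>)"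
    by (intro Bochner_Integration.integral_add integrable_abs integrable_s_diff)
  finally show ?thesis
    using integral_abs_s_diff_le[of x x'] integral_abs_s_diff_le[of y y'] by linarith
qed

definition "K = L * CARD('d)"

lemma L_l1_dist_le: "L * l1_dist x y \<le> K * norm (x - y)" for x y :: "real ^ 'd"
  using mult_left_mono[OF l1_dist_le_norm[of x y] L_nonneg] by (simp add: K_def mult.assoc)

lemma K_nonneg: "0 \<le> K"
  using L_nonneg by (simp add: K_def)

lemma mean_score_measurable [measurable]: "S \<in> borel_measurable borel"
proof (rule borel_measurable_continuous_onI, rule lipschitz_on_continuous_on)
  show "K-lipschitz_on UNIV S"
    using order_trans[OF abs_mean_score_diff_le L_l1_dist_le] K_nonneg
    by (intro lipschitz_onI) (auto simp: dist_norm)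
qed

text \<open>Joint measurability comes from joint Lipschitz continuity, once the product of the Borel
  algebras is identified with the Borel algebra of the product.\<close>

lemma loss_measurable [measurable]: "case_prod \<l> \<in> borel_measurable (borel \<Otimes>\<^sub>M borel)"
  unfolding borel_prod
proof (rule borel_measurable_continuous_onI, rule lipschitz_on_continuous_on)
  have "dist (\<l> x y) (\<l> x' y') \<le> 2 * K * dist (x, y) (x', y')" for x y x' y'
  proof -
    have "\<bar>\<l> x y - \<l> x' y'\<bar> \<le> K * dist x x' + K * dist y y'"
      using abs_loss_diff_le[of x y x' y'] L_l1_dist_le[of x x'] L_l1_dist_le[of y y']
      by (simp add: dist_norm)
    also have "\<dots> \<le> K * dist (x, y) (x', y') + K * dist (x, y) (x', y')"
      using dist_fst_le[of "(x, y)" "(x', y')"] dist_snd_le[of "(x, y)" "(x', y')"]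
      by (intro add_mono mult_left_mono K_nonneg) auto
    finally show ?thesis by (simp add: dist_real_def)
  qed
  thus "(2 * K)-lipschitz_on UNIV (case_prod \<l>)"
    using K_nonneg by (intro lipschitz_onI) auto
qed

lemma loss_comp_measurable [measurable (raw)]:
  assumes "f \<in> borel_measurable M" "g \<in> borel_measurable M"
  shows "(\<lambda>x. \<l> (f x) (g x)) \<in> borel_measurable M"
  using measurable_compose[OF measurable_Pair[OF assms] loss_measurable] by simp

text \<open>Linear growth follows from the Lipschitz bound because the loss vanishes at the origin.
  With finite first moments it makes the loss integrable under every coupling.\<close>

lemma loss_le_norm: "\<l> x y \<le> K * norm x + K * norm y"
proof -
  have "\<l> x y \<le> \<l> 0 0 + (L * l1_dist x 0 + L * l1_dist y 0)"
    using abs_loss_diff_le[of x y 0 0] by linarith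
  also have "\<l> 0 0 = 0" by (simp add: loss_def)
  finally show ?thesis using L_l1_dist_le[of x 0] L_l1_dist_le[of y 0] by simp
qed

lemma integrable_mean_score:
  assumes "finite_measure P" and [measurable_cong]: "sets P = sets borel" and "integrable P norm"
  shows "integrable P S"
proof -
  interpret finite_measure P by fact
  have *: "integrable P (\<lambda>x. \<bar>S 0\<bar> + K * norm x)"
    using assms(3) by simp
  have le: "norm (S x) \<le> norm (\<bar>S 0\<bar> + K * norm x)" for x
    using abs_mean_score_diff_le[of x 0] L_l1_dist_le[of x 0] by simp
  show ?thesis
    by (rule Bochner_Integration.integrable_bound[OF *]) (simp_all only: le, measurable)
qed

end

section \<open>Integrals of the loss against couplings\<close>

locale coupled_scores = lipschitz_score \<Lambda> s L + coupling P Q \<kappa>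
  for \<Lambda> :: "'t measure" and s :: "'t \<Rightarrow> real ^ 'd \<Rightarrow> real" and L and P Q :: "(real ^ 'd) measure" and \<kappa> +
  assumes sets_P [measurable_cong]: "sets P = sets borel"
    and sets_Q [measurable_cong]: "sets Q = sets borel"
    and moment_P: "integrable P norm" and moment_Q: "integrable Q norm"
begin

lemma integrable_loss: "integrable \<kappa> (\<lambda>z. \<l> (fst z) (snd z))"
  and integrable_loss_swap: "integrable \<kappa> (\<lambda>z. \<l> (snd z) (fst z))"
proof -
  have *: "integrable \<kappa> (\<lambda>z. K * norm (fst z) + K * norm (snd z))"
    using integrable_fst[OF moment_P] integrable_snd[OF moment_Q] by simp
  have le: "norm (\<l> x y) \<le> norm (K * norm x + K * norm y)"
      "norm (\<l> y x) \<le> norm (K * norm x + K * norm y)" for x y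
    using loss_le_norm[of x y] loss_le_norm[of y x] loss_nonneg[of x y] loss_nonneg[of y x]
    by auto
  show "integrable \<kappa> (\<lambda>z. \<l> (fst z) (snd z))"
    by (rule Bochner_Integration.integrable_bound[OF *]) (simp_all only: le, measurable)
  show "integrable \<kappa> (\<lambda>z. \<l> (snd z) (fst z))"
    by (rule Bochner_Integration.integrable_bound[OF *]) (simp_all only: le, measurable)
qed

text \<open>By \<open>loss_diff_swap\<close> the two losses differ by \<open>S y - S x\<close>, a
  sum of functions of one coordinate each, whose integral sees only the marginals. Hence the
  correction is the same for every coupling.\<close>

lemma integral_loss_swap:
  "(\<integral>(x, y). \<l> y x \<partial>\<kappa>) = (\<integral>(x, y). \<l> x y \<partial>\<kappa>) + ((\<integral>y. S y \<partial>Q) - (\<integral>x. S x \<partial>P))"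
proof -
  have S: "integrable P S" "integrable Q S"
    using moment_P moment_Q sets_P sets_Q P.finite_measure_axioms Q.finite_measure_axioms
    by (auto intro: integrable_mean_score)
  have "(\<integral>z. \<l> (snd z) (fst z) \<partial>\<kappa>) = (\<integral>z. \<l> (fst z) (snd z) + (S (snd z) - S (fst z)) \<partial>\<kappa>)"
  proof (intro Bochner_Integration.integral_cong refl)
    fix z show "\<l> (snd z) (fst z) = \<l> (fst z) (snd z) + (S (snd z) - S (fst z))"
      using loss_diff_swap[of "fst z" "snd z"] by linarith
  qed
  also have "\<dots> = (\<integral>z. \<l> (fst z) (snd z) \<partial>\<kappa>) + ((\<integral>y. S y \<partial>Q) - (\<integral>x. S x \<partial>P))"
    using integrable_loss integrable_fst[OF S(1)] integrable_snd[OF S(2)]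
    by (simp add: integral_fst integral_snd)
  finally show ?thesis by (simp add: case_prod_beta')
qed

lemma integral_gap:
  "(\<integral>(x, y). \<l> x y - \<gamma> * \<l> y x \<partial>\<kappa>) =
    (1 - \<gamma>) * (\<integral>(x, y). \<l> x y \<partial>\<kappa>) - \<gamma> * ((\<integral>y. S y \<partial>Q) - (\<integral>x. S x \<partial>P))"
proof -
  have "(\<integral>(x, y). \<l> x y - \<gamma> * \<l> y x \<partial>\<kappa>) = (\<integral>(x, y). \<l> x y \<partial>\<kappa>) - \<gamma> * (\<integral>(x, y). \<l> y x \<partial>\<kappa>)"
    using integrable_loss integrable_loss_swap by (simp add: case_prod_beta')
  thus ?thesis unfolding integral_loss_swap by (simp add: algebra_simps)
qed

end

section \<open>The gap and its relation to CSD\<close>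

locale score_problem = lipschitz_score \<Lambda> s L + P: prob_space P + Q: prob_space Q
  for \<Lambda> :: "'t measure" and s :: "'t \<Rightarrow> real ^ 'd \<Rightarrow> real" and L and P Q :: "(real ^ 'd) measure" +
  assumes sets_P [measurable_cong]: "sets P = sets borel"
    and sets_Q [measurable_cong]: "sets Q = sets borel"
    and moment_P: "integrable P norm" and moment_Q: "integrable Q norm"
begin

definition "\<Delta> = (\<integral>y. S y \<partial>Q) - (\<integral>x. S x \<partial>P)"

lemma coupled: "\<kappa> \<in> couplings P Q \<Longrightarrow> coupled_scores \<Lambda> s L P Q \<kappa>"
  by unfold_locales (auto simp: sets_P sets_Q moment_P moment_Q)

lemma couplings_nonempty: "couplings P Q \<noteq> {}"
  using pair_measure_in_couplings[OF P.prob_space_axioms Q.prob_space_axioms] by auto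

lemma integral_loss_nonneg: "0 \<le> (\<integral>(x, y). \<l> x y \<partial>\<kappa>)"
  and integral_loss_swap_nonneg: "0 \<le> (\<integral>(x, y). \<l> y x \<partial>\<kappa>)"
  by (rule Bochner_Integration.integral_nonneg, simp add: loss_nonneg split_beta)+

lemma bdd_below_loss: "bdd_below ((\<lambda>\<kappa>. \<integral>(x, y). \<l> x y \<partial>\<kappa>) ` A)"
  by (rule bdd_belowI2[of _ 0]) (rule integral_loss_nonneg)

lemma min_loss_le: "\<kappa> \<in> couplings P Q \<Longrightarrow> min_loss \<Lambda> s P Q \<le> (\<integral>(x, y). \<l> x y \<partial>\<kappa>)"
  unfolding min_loss_def by (rule cINF_lower[OF bdd_below_loss])

text \<open>The map from the loss of a coupling to its gap is affine with slope
  \<open>1 - \<gamma>\<close>, which is nonnegative on the unit interval; a continuous nondecreasing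
  map commutes with the infimum of a nonempty set bounded below.\<close>

lemma csd_gap_eq:
  assumes \<gamma>: "\<gamma> \<in> {0..1}"
  shows "csd_gap \<Lambda> s \<gamma> P Q = (1 - \<gamma>) * min_loss \<Lambda> s P Q - \<gamma> * \<Delta>"
proof -
  have mono: "mono (\<lambda>a. (1 - \<gamma>) * a - \<gamma> * \<Delta>)"
    using \<gamma> by (auto intro!: monoI mult_left_mono)
  have "csd_gap \<Lambda> s \<gamma> P Q = (INF \<kappa>\<in>couplings P Q. (1 - \<gamma>) * (\<integral>(x, y). \<l> x y \<partial>\<kappa>) - \<gamma> * \<Delta>)"
    unfolding csd_gap_def \<Delta>_def
    by (intro INF_cong refl coupled_scores.integral_gap[OF coupled])
  also have "\<dots> = (1 - \<gamma>) * min_loss \<Lambda> s P Q - \<gamma> * \<Delta>"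
    unfolding min_loss_def
    using continuous_at_Inf_mono[OF mono, of "(\<lambda>\<kappa>. \<integral>(x, y). \<l> x y \<partial>\<kappa>) ` couplings P Q"]
      couplings_nonempty bdd_below_loss
    by (simp add: image_image continuous_intros)
  finally show ?thesis .
qed

lemma csd_iff:
  "csd \<Lambda> s \<gamma> P Q \<longleftrightarrow> (\<exists>\<kappa>\<in>couplings P Q. (1 - \<gamma>) * (\<integral>(x, y). \<l> x y \<partial>\<kappa>) - \<gamma> * \<Delta> \<le> 0)"
  unfolding csd_def \<Delta>_def
  by (intro bex_cong refl, subst coupled_scores.integral_loss_swap[OF coupled], assumption)
    (auto simp: algebra_simps)

text \<open>The reversed loss has a nonnegative integral, so a coupling that works for \<gamma>
  works for every larger value.\<close>

lemma csd_mono: "csd \<Lambda> s \<gamma> P Q \<Longrightarrow> \<gamma> \<le> \<gamma>' \<Longrightarrow> csd \<Lambda> s \<gamma>' P Q"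
  unfolding csd_def
  by (elim bexE, rule bexI, erule order_trans)
    (auto intro: mult_right_mono integral_loss_swap_nonneg)

text \<open>The set is closed upwards, so its indicator is a monotone function and thus Borel. This
  makes the failure event for a random \<gamma> measurable.\<close>

lemma csd_measurable: "{\<gamma>. csd \<Lambda> s \<gamma> P Q} \<in> sets borel"
proof -
  have "mono (\<lambda>\<gamma>. of_bool (csd \<Lambda> s \<gamma> P Q) :: real)"
    using csd_mono by (auto intro!: monoI)
  from borel_measurable_mono[OF this]
  have "(\<lambda>\<gamma>. of_bool (csd \<Lambda> s \<gamma> P Q) :: real) -` {1} \<inter> space borel \<in> sets borel"
    by (rule measurable_sets) simp
  thus ?thesis by (simp add: vimage_def)
qed

text \<open>Some coupling lies strictly below 0 when the infimum does, so the infimum need not be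
  attained.\<close>

lemma csd_if_gap_negative:
  assumes "\<gamma> \<in> {0..1}" "csd_gap \<Lambda> s \<gamma> P Q < 0"
  shows "csd \<Lambda> s \<gamma> P Q"
proof -
  have "\<exists>\<kappa>\<in>couplings P Q. (\<integral>(x, y). \<l> x y - \<gamma> * \<l> y x \<partial>\<kappa>) < 0"
    using cInf_lessD[OF _ assms(2)[unfolded csd_gap_def]] couplings_nonempty by auto
  then obtain \<kappa> where \<kappa>: "\<kappa> \<in> couplings P Q" "(\<integral>(x, y). \<l> x y - \<gamma> * \<l> y x \<partial>\<kappa>) < 0" by blast
  thus ?thesis
    unfolding csd_iff using coupled_scores.integral_gap[OF coupled[OF \<kappa>(1)], of \<gamma>]
    by (auto simp: \<Delta>_def intro!: bexI[of _ \<kappa>])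
qed

text \<open>At \<gamma> = 1 the loss term has coefficient 0 and the gap is \<open>- \<Delta>\<close>
  under every coupling, so any coupling is a witness.\<close>

lemma csd_1:
  assumes "csd_gap \<Lambda> s 1 P Q \<le> 0"
  shows "csd \<Lambda> s 1 P Q"
  using assms couplings_nonempty by (auto simp: csd_gap_eq csd_iff)

text \<open>Every coupling is concentrated on \<open>A \<times> B\<close>, where the loss is
  \<open>l\<close>. All couplings thus have the same cost, and each one attains the infimum.\<close>

lemma csd_if_loss_constant:
  assumes \<gamma>: "\<gamma> \<in> {0..1}" "csd_gap \<Lambda> s \<gamma> P Q \<le> 0"
    and A: "AE x in P. x \<in> A" and B: "AE y in Q. y \<in> B"
    and const: "\<And>x y. x \<in> A \<Longrightarrow> y \<in> B \<Longrightarrow> \<l> x y = l"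
  shows "csd \<Lambda> s \<gamma> P Q"
proof -
  have l: "(\<integral>(x, y). \<l> x y \<partial>\<kappa>) = l" if "\<kappa> \<in> couplings P Q" for \<kappa>
  proof -
    interpret coupled_scores \<Lambda> s L P Q \<kappa> by (rule coupled[OF that])
    have "(\<integral>z. \<l> (fst z) (snd z) \<partial>\<kappa>) = (\<integral>z. l \<partial>\<kappa>)"
      by (rule integral_cong_AE) (use AE_fst[OF A] AE_snd[OF B] const in auto)
    thus ?thesis by (simp add: case_prod_beta' prob_space)
  qed
  have "min_loss \<Lambda> s P Q = l"
    unfolding min_loss_def using l couplings_nonempty by simp
  moreover obtain \<kappa> where "\<kappa> \<in> couplings P Q" using couplings_nonempty by blast
  ultimately show ?thesis
    using \<gamma> l by (auto simp: csd_gap_eq csd_iff intro!: bexI[of _ \<kappa>])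
qed

end

section \<open>Transport plans between empirical measures\<close>

text \<open>The transportation polytope of two uniform weights. Rows and columns are indexed by
  sample positions instead of values, so repeated observations cause no trouble, and the polytope
  stays fixed while the data enter through the cost matrix alone.\<close>

definition plans :: "nat \<Rightarrow> nat \<Rightarrow> (nat \<times> nat \<Rightarrow> real) set" where
  "plans m n = {\<pi>. (\<forall>i<m. \<forall>j<n. 0 \<le> \<pi> (i, j)) \<and>
     (\<forall>i<m. (\<Sum>j<n. \<pi> (i, j)) = 1 / real m) \<and> (\<forall>j<n. (\<Sum>i<m. \<pi> (i, j)) = 1 / real n)}"

definition plan_cost :: "nat \<Rightarrow> nat \<Rightarrow> (nat \<Rightarrow> nat \<Rightarrow> real) \<Rightarrow> (nat \<times> nat \<Rightarrow> real) \<Rightarrow> real" where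
  "plan_cost m n c \<pi> = (\<Sum>i<m. \<Sum>j<n. \<pi> (i, j) * c i j)"

definition ot_cost :: "nat \<Rightarrow> nat \<Rightarrow> (nat \<Rightarrow> nat \<Rightarrow> real) \<Rightarrow> real" where
  "ot_cost m n c = (INF \<pi>\<in>plans m n. plan_cost m n c \<pi>)"

lemma uniform_plan: "0 < m \<Longrightarrow> 0 < n \<Longrightarrow> (\<lambda>_. 1 / (real m * real n)) \<in> plans m n"
  by (simp add: plans_def)

lemma plan_cost_nonneg:
  assumes "\<pi> \<in> plans m n" "\<And>i j. i < m \<Longrightarrow> j < n \<Longrightarrow> 0 \<le> c i j"
  shows "0 \<le> plan_cost m n c \<pi>"
  using assms by (auto simp: plan_cost_def plans_def intro!: sum_nonneg)

lemma ot_cost_cong: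
  assumes "\<And>i j. i < m \<Longrightarrow> j < n \<Longrightarrow> c i j = c' i j"
  shows "ot_cost m n c = ot_cost m n c'"
proof -
  have "plan_cost m n c = plan_cost m n c'"
    using assms by (simp add: plan_cost_def fun_eq_iff)
  thus ?thesis by (simp add: ot_cost_def)
qed

lemma bdd_below_plan_cost:
  assumes "\<And>i j. i < m \<Longrightarrow> j < n \<Longrightarrow> 0 \<le> c i j"
  shows "bdd_below (plan_cost m n c ` plans m n)"
  by (rule bdd_belowI2[of _ 0]) (use assms in \<open>auto intro: plan_cost_nonneg\<close>)

lemma ot_cost_le:
  assumes "\<And>i j. i < m \<Longrightarrow> j < n \<Longrightarrow> 0 \<le> c i j" "\<pi> \<in> plans m n"
  shows "ot_cost m n c \<le> plan_cost m n c \<pi>"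
  unfolding ot_cost_def using assms by (intro cINF_lower bdd_below_plan_cost)

lemma ot_cost_nonneg:
  assumes "0 < m" "0 < n" "\<And>i j. i < m \<Longrightarrow> j < n \<Longrightarrow> 0 \<le> c i j"
  shows "0 \<le> ot_cost m n c"
  unfolding ot_cost_def using assms uniform_plan[of m n]
  by (intro cINF_greatest) (auto intro: plan_cost_nonneg)

text \<open>The two costs of each plan are within \<open>b\<close>, and infima over the same
  nonempty set inherit this. Nonnegativity bounds both sets of costs from below.\<close>

lemma ot_cost_diff_le:
  assumes "0 < m" "0 < n"
    and c: "\<And>i j. i < m \<Longrightarrow> j < n \<Longrightarrow> 0 \<le> c i j" and c': "\<And>i j. i < m \<Longrightarrow> j < n \<Longrightarrow> 0 \<le> c' i j"
    and diff: "\<And>\<pi>. \<pi> \<in> plans m n \<Longrightarrow> \<bar>plan_cost m n c \<pi> - plan_cost m n c' \<pi>\<bar> \<le> b"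
  shows "\<bar>ot_cost m n c - ot_cost m n c'\<bar> \<le> b"
proof -
  have ne: "plans m n \<noteq> {}" using uniform_plan[OF assms(1,2)] by blast
  have "ot_cost m n c - b \<le> ot_cost m n c'"
    unfolding ot_cost_def[of m n c'] using ot_cost_le[OF c] diff
    by (intro cINF_greatest[OF ne]) fastforce
  moreover have "ot_cost m n c' - b \<le> ot_cost m n c"
    unfolding ot_cost_def[of m n c] using ot_cost_le[OF c'] diff
    by (intro cINF_greatest[OF ne]) fastforce
  ultimately show ?thesis by linarith
qed

text \<open>Only row \<open>i\<close> contributes to the difference, and a plan puts mass
  \<open>1 / real m\<close> on it. Replacing one of \<open>m\<close> observations therefore moves
  the cost by a fraction \<open>1 / m\<close> of the oscillation, the scaling that McDiarmid's
  inequality turns into the variance term.\<close>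

lemma plan_cost_row_diff:
  assumes \<pi>: "\<pi> \<in> plans m n" and i: "i < m"
    and eq: "\<And>k j. k < m \<Longrightarrow> k \<noteq> i \<Longrightarrow> j < n \<Longrightarrow> c k j = c' k j"
    and le: "\<And>j. j < n \<Longrightarrow> \<bar>c i j - c' i j\<bar> \<le> b"
  shows "\<bar>plan_cost m n c \<pi> - plan_cost m n c' \<pi>\<bar> \<le> b / real m"
proof -
  have "plan_cost m n c \<pi> - plan_cost m n c' \<pi> = (\<Sum>k<m. \<Sum>j<n. \<pi> (k, j) * (c k j - c' k j))"
    by (simp add: plan_cost_def sum_subtractf[symmetric] right_diff_distrib)
  also have "\<dots> = (\<Sum>k\<in>{i}. \<Sum>j<n. \<pi> (k, j) * (c k j - c' k j))"
    using i eq by (intro sum.mono_neutral_right) auto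
  also have "\<bar>\<dots>\<bar> \<le> (\<Sum>j<n. \<pi> (i, j) * b)"
    using \<pi> i le by (auto simp: plans_def abs_mult intro!: order_trans[OF sum_abs] sum_mono mult_left_mono)
  also have "\<dots> = b / real m"
    using \<pi> i by (simp add: plans_def sum_distrib_right[symmetric])
  finally show ?thesis .
qed

lemma plan_cost_column_diff:
  assumes \<pi>: "\<pi> \<in> plans m n" and j: "j < n"
    and eq: "\<And>i k. i < m \<Longrightarrow> k < n \<Longrightarrow> k \<noteq> j \<Longrightarrow> c i k = c' i k"
    and le: "\<And>i. i < m \<Longrightarrow> \<bar>c i j - c' i j\<bar> \<le> b"
  shows "\<bar>plan_cost m n c \<pi> - plan_cost m n c' \<pi>\<bar> \<le> b / real n"
proof -
  \<comment> \<open>The transposed plan turns the column into a row.\<close>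
  have flip: "(\<lambda>(k, i). \<pi> (i, k)) \<in> plans n m"
    using \<pi> by (auto simp: plans_def)
  have "plan_cost m n f \<pi> = plan_cost n m (\<lambda>k i. f i k) (\<lambda>(k, i). \<pi> (i, k))" for f
    unfolding plan_cost_def by (subst sum.swap) simp
  thus ?thesis
    using plan_cost_row_diff[OF flip j, of "\<lambda>k i. c i k" "\<lambda>k i. c' i k" b] eq le by simp
qed

text \<open>The sequence is chosen before the cost matrix, so it can be fixed independently of the
  data. It enumerates a countable dense subset of \<open>plans m n\<close> in the product topology,
  for which each cost is continuous as a function of finitely many entries.\<close>

lemma plans_dense_sequence:
  assumes "0 < m" "0 < n"
  obtains T :: "nat \<Rightarrow> nat \<times> nat \<Rightarrow> real" where "range T \<subseteq> plans m n"
    "\<forall>c. \<forall>\<pi>\<in>plans m n. \<forall>\<epsilon>>0. \<exists>k. plan_cost m n c (T k) < plan_cost m n c \<pi> + \<epsilon>"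
proof -
  obtain D :: "(nat \<times> nat \<Rightarrow> real) set" where D: "countable D" "D \<subseteq> plans m n" "plans m n \<subseteq> closure D"
    using separable[of "plans m n"] by blast
  have ne: "D \<noteq> {}" using D(3) uniform_plan[OF assms] by auto
  show ?thesis
  proof (rule that[of "from_nat_into D"])
    show "range (from_nat_into D) \<subseteq> plans m n"
      using from_nat_into[OF ne] D(2) by blast
    show "\<forall>c. \<forall>\<pi>\<in>plans m n. \<forall>\<epsilon>>0. \<exists>k.
      plan_cost m n c (from_nat_into D k) < plan_cost m n c \<pi> + \<epsilon>"
    proof (intro allI ballI impI)
      fix c \<pi> and \<epsilon> :: real assume "\<pi> \<in> plans m n" "0 < \<epsilon>"
      let ?U = "{\<tau>. plan_cost m n c \<tau> < plan_cost m n c \<pi> + \<epsilon>}"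
      have "open ?U"
        unfolding plan_cost_def by (intro open_Collect_less continuous_intros continuous_on_product_coordinates)
      moreover have "\<pi> \<in> ?U" "\<pi> \<in> closure D"
        using \<open>0 < \<epsilon>\<close> \<open>\<pi> \<in> plans m n\<close> D(3) by auto
      ultimately have "D \<inter> ?U \<noteq> {}"
        using closure_iff_nhds_not_empty by blast
      then obtain \<tau> where \<tau>: "\<tau> \<in> D" "plan_cost m n c \<tau> < plan_cost m n c \<pi> + \<epsilon>" by auto
      from from_nat_into_surj[OF D(1) \<tau>(1)] \<tau>(2)
      show "\<exists>k. plan_cost m n c (from_nat_into D k) < plan_cost m n c \<pi> + \<epsilon>" by auto
    qed
  qed
qed

lemma ot_cost_eq_INF_sequence:
  fixes T :: "nat \<Rightarrow> nat \<times> nat \<Rightarrow> real"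
  assumes "0 < m" "0 < n" and c: "\<And>i j. i < m \<Longrightarrow> j < n \<Longrightarrow> 0 \<le> c i j"
    and "range T \<subseteq> plans m n"
    and dense: "\<forall>\<pi>\<in>plans m n. \<forall>\<epsilon>>0. \<exists>k. plan_cost m n c (T k) < plan_cost m n c \<pi> + \<epsilon>"
  shows "ot_cost m n c = (INF k. plan_cost m n c (T k))"
proof (rule antisym)
  have T: "T k \<in> plans m n" for k using assms(4) by auto
  show "ot_cost m n c \<le> (INF k. plan_cost m n c (T k))"
    using ot_cost_le[OF c T] by (intro cINF_greatest) auto
  have bdd: "bdd_below (range (\<lambda>k. plan_cost m n c (T k)))"
    by (rule bdd_belowI2[of _ 0]) (use plan_cost_nonneg[OF T] c in auto)
  have "(INF k. plan_cost m n c (T k)) \<le> plan_cost m n c \<pi>" if "\<pi> \<in> plans m n" for \<pi>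
  proof (rule field_le_epsilon)
    fix \<epsilon> :: real assume "0 < \<epsilon>"
    then obtain k where "plan_cost m n c (T k) < plan_cost m n c \<pi> + \<epsilon>"
      using dense \<open>\<pi> \<in> plans m n\<close> by blast
    thus "(INF k. plan_cost m n c (T k)) \<le> plan_cost m n c \<pi> + \<epsilon>"
      using cINF_lower[OF bdd, of k] by simp
  qed
  thus "(INF k. plan_cost m n c (T k)) \<le> ot_cost m n c"
    unfolding ot_cost_def using uniform_plan[OF assms(1,2)] by (intro cINF_greatest) auto
qed

text \<open>The infimum over all plans equals the one over a fixed sequence of plans, which is a
  countable infimum of measurable functions.\<close>

lemma ot_cost_measurable:
  assumes "0 < m" "0 < n"
    and c: "\<And>\<omega> i j. \<omega> \<in> space M \<Longrightarrow> i < m \<Longrightarrow> j < n \<Longrightarrow> 0 \<le> c \<omega> i j"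
    and [measurable]: "\<And>i j. i < m \<Longrightarrow> j < n \<Longrightarrow> (\<lambda>\<omega>. c \<omega> i j) \<in> borel_measurable M"
  shows "(\<lambda>\<omega>. ot_cost m n (c \<omega>)) \<in> borel_measurable M"
proof -
  obtain T :: "nat \<Rightarrow> _" where T: "range T \<subseteq> plans m n"
    "\<forall>c. \<forall>\<pi>\<in>plans m n. \<forall>\<epsilon>>0. \<exists>k. plan_cost m n c (T k) < plan_cost m n c \<pi> + \<epsilon>"
    by (rule plans_dense_sequence[OF assms(1,2)]) (rule that)
  have "(\<lambda>\<omega>. INF k. plan_cost m n (c \<omega>) (T k)) \<in> borel_measurable M"
    unfolding plan_cost_def by (intro borel_measurable_cINF_real) auto
  thus ?thesis
    using ot_cost_eq_INF_sequence[OF assms(1,2) c T(1) spec[OF T(2)]] by (subst measurable_cong) auto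
qed

text \<open>Draw an index pair \<open>(i, j)\<close> from the random plan \<open>W \<omega>\<close> and record \<open>(X i \<omega>, Y j \<omega>)\<close>.\<close>

lemma random_plan_coupling:
  fixes X :: "nat \<Rightarrow> 'w \<Rightarrow> 'a::topological_space" and Y :: "nat \<Rightarrow> 'w \<Rightarrow> 'b::topological_space"
  assumes M: "sigma_finite_measure M"
    and X [measurable]: "\<And>i. i < m \<Longrightarrow> X i \<in> borel_measurable M"
    and Y [measurable]: "\<And>j. j < n \<Longrightarrow> Y j \<in> borel_measurable M"
    and W [measurable]: "\<And>i j. i < m \<Longrightarrow> j < n \<Longrightarrow> (\<lambda>\<omega>. W \<omega> (i, j)) \<in> borel_measurable M"
    and plan: "\<And>\<omega>. \<omega> \<in> space M \<Longrightarrow> W \<omega> \<in> plans m n"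
    and P: "sets P = sets borel" "\<And>A. A \<in> sets borel \<Longrightarrow>
      emeasure P A = (\<integral>\<^sup>+\<omega>. (\<Sum>i<m. ennreal (1 / real m) * indicator A (X i \<omega>)) \<partial>M)"
    and Q: "sets Q = sets borel" "\<And>A. A \<in> sets borel \<Longrightarrow>
      emeasure Q A = (\<integral>\<^sup>+\<omega>. (\<Sum>j<n. ennreal (1 / real n) * indicator A (Y j \<omega>)) \<partial>M)"
  obtains \<kappa> where "\<kappa> \<in> couplings P Q"
    "\<And>c. c \<in> borel_measurable (borel \<Otimes>\<^sub>M borel) \<Longrightarrow> (\<And>z. 0 \<le> c z) \<Longrightarrow> (\<integral>\<^sup>+z. ennreal (c z) \<partial>\<kappa>) =
      (\<integral>\<^sup>+\<omega>. ennreal (plan_cost m n (\<lambda>i j. c (X i \<omega>, Y j \<omega>)) (W \<omega>)) \<partial>M)"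
proof -
  interpret M: sigma_finite_measure M by fact
  define I where "I = {..<m} \<times> {..<n}"
  \<comment> \<open>\<open>N\<close> carries an index pair together with an outcome. The density
    \<open>w\<close> weights the pair by the plan of that outcome, and \<open>Z\<close> reads off
    the two observations.\<close>
  define N where "N = count_space I \<Otimes>\<^sub>M M"
  define w where "w = (\<lambda>(p, \<omega>). ennreal (W \<omega> p))"
  define Z where "Z = (\<lambda>((i, j), \<omega>). (X i \<omega>, Y j \<omega>))"
  have [simp]: "finite I" by (simp add: I_def)
  have w [measurable]: "w \<in> borel_measurable N"
    unfolding N_def w_def by (rule measurable_pair_measure_countable1) (auto simp: I_def countable_finite)
  have Z [measurable]: "Z \<in> N \<rightarrow>\<^sub>M borel \<Otimes>\<^sub>M borel"
    unfolding N_def Z_def by (rule measurable_pair_measure_countable1) (auto simp: I_def countable_finite)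
  define \<kappa> where "\<kappa> = distr (density N w) (borel \<Otimes>\<^sub>M borel) Z"
  have nn: "(\<integral>\<^sup>+z. f z \<partial>\<kappa>) = (\<integral>\<^sup>+\<omega>. (\<Sum>i<m. \<Sum>j<n. ennreal (W \<omega> (i, j)) * f (X i \<omega>, Y j \<omega>)) \<partial>M)"
    if f [measurable]: "f \<in> borel_measurable (borel \<Otimes>\<^sub>M borel)" for f
  proof -
    have "(\<integral>\<^sup>+z. f z \<partial>\<kappa>) = (\<integral>\<^sup>+z. w z * f (Z z) \<partial>N)"
      unfolding \<kappa>_def by (simp add: nn_integral_distr nn_integral_density)
    also have "\<dots> = (\<integral>\<^sup>+p. \<integral>\<^sup>+\<omega>. w (p, \<omega>) * f (Z (p, \<omega>)) \<partial>M \<partial>count_space I)"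
      unfolding N_def by (subst M.nn_integral_fst[symmetric]) (simp_all add: N_def[symmetric])
    also have "\<dots> = (\<Sum>p\<in>I. \<integral>\<^sup>+\<omega>. w (p, \<omega>) * f (Z (p, \<omega>)) \<partial>M)"
      by (simp add: nn_integral_count_space_finite)
    also have "\<dots> = (\<integral>\<^sup>+\<omega>. (\<Sum>p\<in>I. w (p, \<omega>) * f (Z (p, \<omega>))) \<partial>M)"
      by (rule nn_integral_sum[symmetric]) (auto simp: I_def w_def Z_def)
    finally show ?thesis
      by (simp add: I_def w_def Z_def sum.cartesian_product split_beta)
  qed
  have sets_\<kappa> [measurable_cong]: "sets \<kappa> = sets (borel \<Otimes>\<^sub>M borel)" by (simp add: \<kappa>_def)
  note [measurable_cong] = P(1) Q(1)
  have "distr \<kappa> P fst = P"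
  proof (rule measure_eqI)
    fix A assume "A \<in> sets (distr \<kappa> P fst)"
    hence A [measurable]: "A \<in> sets borel" by (simp add: P)
    have "emeasure (distr \<kappa> P fst) A = (\<integral>\<^sup>+z. indicator A (fst z) \<partial>\<kappa>)"
      by (subst nn_integral_indicator[symmetric], simp add: P, subst nn_integral_distr) (auto simp: P)
    also have "\<dots> = (\<integral>\<^sup>+\<omega>. (\<Sum>i<m. \<Sum>j<n. ennreal (W \<omega> (i, j)) * indicator A (X i \<omega>)) \<partial>M)"
      by (subst nn) auto
    \<comment> \<open>The row sums of the plan equal \<open>1 / real m\<close> at every outcome, so
      summing over \<open>j\<close> leaves exactly the mixture that is assumed to represent
      \<open>P\<close>. The second marginal uses the column sums in the same way.\<close>
    also have "\<dots> = (\<integral>\<^sup>+\<omega>. (\<Sum>i<m. ennreal (1 / real m) * indicator A (X i \<omega>)) \<partial>M)"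
    proof (intro nn_integral_cong sum.cong refl)
      fix \<omega> i assume "\<omega> \<in> space M" "i \<in> {..<m}"
      with plan[of \<omega>] have "(\<Sum>j<n. ennreal (W \<omega> (i, j))) = ennreal (1 / real m)"
        by (subst sum_ennreal) (auto simp: plans_def)
      thus "(\<Sum>j<n. ennreal (W \<omega> (i, j)) * indicator A (X i \<omega>)) =
          ennreal (1 / real m) * indicator A (X i \<omega>)"
        by (simp add: sum_distrib_right[symmetric])
    qed
    also have "\<dots> = emeasure P A" by (simp add: P(2))
    finally show "emeasure (distr \<kappa> P fst) A = emeasure P A" .
  qed simp
  moreover have "distr \<kappa> Q snd = Q"
  proof (rule measure_eqI)
    fix A assume "A \<in> sets (distr \<kappa> Q snd)"
    hence A [measurable]: "A \<in> sets borel" by (simp add: Q)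
    have "emeasure (distr \<kappa> Q snd) A = (\<integral>\<^sup>+z. indicator A (snd z) \<partial>\<kappa>)"
      by (subst nn_integral_indicator[symmetric], simp add: Q, subst nn_integral_distr) (auto simp: Q)
    also have "\<dots> = (\<integral>\<^sup>+\<omega>. (\<Sum>j<n. \<Sum>i<m. ennreal (W \<omega> (i, j)) * indicator A (Y j \<omega>)) \<partial>M)"
      by (subst nn, simp, subst sum.swap) auto
    also have "\<dots> = (\<integral>\<^sup>+\<omega>. (\<Sum>j<n. ennreal (1 / real n) * indicator A (Y j \<omega>)) \<partial>M)"
    proof (intro nn_integral_cong sum.cong refl)
      fix \<omega> j assume "\<omega> \<in> space M" "j \<in> {..<n}"
      with plan[of \<omega>] have "(\<Sum>i<m. ennreal (W \<omega> (i, j))) = ennreal (1 / real n)"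
        by (subst sum_ennreal) (auto simp: plans_def)
      thus "(\<Sum>i<m. ennreal (W \<omega> (i, j)) * indicator A (Y j \<omega>)) =
          ennreal (1 / real n) * indicator A (Y j \<omega>)"
        by (simp add: sum_distrib_right[symmetric])
    qed
    also have "\<dots> = emeasure Q A" by (simp add: Q(2))
    finally show "emeasure (distr \<kappa> Q snd) A = emeasure Q A" .
  qed simp
  ultimately have "\<kappa> \<in> couplings P Q"
    by (simp add: couplings_def sets_\<kappa> P(1) Q(1) cong: sets_pair_measure_cong)
  moreover have "(\<integral>\<^sup>+z. ennreal (c z) \<partial>\<kappa>) =
      (\<integral>\<^sup>+\<omega>. ennreal (plan_cost m n (\<lambda>i j. c (X i \<omega>, Y j \<omega>)) (W \<omega>)) \<partial>M)"
    if [measurable]: "c \<in> borel_measurable (borel \<Otimes>\<^sub>M borel)" and c: "\<And>z. 0 \<le> c z" for c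
  proof -
    have "(\<Sum>i<m. \<Sum>j<n. ennreal (W \<omega> (i, j)) * ennreal (c (X i \<omega>, Y j \<omega>))) =
        ennreal (plan_cost m n (\<lambda>i j. c (X i \<omega>, Y j \<omega>)) (W \<omega>))" if "\<omega> \<in> space M" for \<omega>
    proof -
      have W: "0 \<le> W \<omega> (i, j)" if "i < m" "j < n" for i j
        using plan[OF \<open>\<omega> \<in> space M\<close>] that by (auto simp: plans_def)
      have "(\<Sum>i<m. \<Sum>j<n. ennreal (W \<omega> (i, j)) * ennreal (c (X i \<omega>, Y j \<omega>))) =
          (\<Sum>i<m. \<Sum>j<n. ennreal (W \<omega> (i, j) * c (X i \<omega>, Y j \<omega>)))"
        using W c by (intro sum.cong refl) (simp add: ennreal_mult)
      also have "\<dots> = (\<Sum>i<m. ennreal (\<Sum>j<n. W \<omega> (i, j) * c (X i \<omega>, Y j \<omega>)))"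
        using W c by (intro sum.cong refl sum_ennreal) auto
      also have "\<dots> = ennreal (plan_cost m n (\<lambda>i j. c (X i \<omega>, Y j \<omega>)) (W \<omega>))"
        unfolding plan_cost_def using W c by (intro sum_ennreal) (auto intro!: sum_nonneg)
      finally show ?thesis .
    qed
    thus ?thesis by (subst nn) (auto intro!: nn_integral_cong)
  qed
  ultimately show ?thesis by (rule that)
qed

section \<open>Couplings of empirical measures as transport plans\<close>

lemma prob_space_empirical: "0 < m \<Longrightarrow> prob_space (empirical m x)"
  unfolding empirical_def
  by (intro prob_space.prob_space_distr prob_space_uniform_count_measure)
    (auto simp: measurable_def space_uniform_count_measure sets_uniform_count_measure)

lemma sets_empirical [simp, measurable_cong]: "sets (empirical m x) = sets borel"
  by (simp add: empirical_def)

lemma AE_empirical: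
  fixes x :: "nat \<Rightarrow> 'a::t1_space"
  assumes "0 < m"
  shows "AE u in empirical m x. u \<in> x ` {..<m}"
proof -
  interpret prob_space "empirical m x" by (rule prob_space_empirical[OF assms])
  have "emeasure (empirical m x) (x ` {..<m}) = 1"
    using assms by (subst emeasure_empirical) (auto intro: finite_imp_closed borel_closed)
  thus ?thesis by (intro AE_prob_1) (simp add: emeasure_eq_measure)
qed

text \<open>A value taken at several positions is counted once per position, and division by its
  multiplicity undoes this. The identity translates between sums over sample positions and sums over
  distinct atoms.\<close>

lemma sum_div_multiplicity:
  fixes g :: "'a \<Rightarrow> real" and x :: "nat \<Rightarrow> 'a"
  shows "(\<Sum>i<m. g (x i) / card {k. k < m \<and> x k = x i}) = (\<Sum>u\<in>x ` {..<m}. g u)"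
proof -
  have "(\<Sum>i<m. g (x i) / card {k. k < m \<and> x k = x i}) =
      (\<Sum>u\<in>x ` {..<m}. \<Sum>i\<in>{i \<in> {..<m}. x i = u}. g (x i) / card {k. k < m \<and> x k = x i})"
    by (rule sum.image_gen) simp
  also have "\<dots> = (\<Sum>u\<in>x ` {..<m}. g u)"
  proof (rule sum.cong[OF refl])
    fix u assume "u \<in> x ` {..<m}"
    hence "card {k. k < m \<and> x k = u} \<noteq> 0" by (auto simp: card_eq_0_iff)
    thus "(\<Sum>i\<in>{i \<in> {..<m}. x i = u}. g (x i) / card {k. k < m \<and> x k = x i}) = g u"
      by (simp add: lessThan_def)
  qed
  finally show ?thesis .
qed

text \<open>The mass of \<kappa> at an atom \<open>(u, v)\<close> is divided equally among the index
  pairs with \<open>x i = u\<close> and \<open>y j = v\<close>. The denominators \<open>a i\<close>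
  and \<open>b j\<close> in \<pi> are the multiplicities of the two values; they cancel against the
  empirical masses \<open>a i / m\<close> and \<open>b j / n\<close>.\<close>

lemma empirical_coupling_plan:
  fixes x :: "nat \<Rightarrow> 'a::t1_space" and y :: "nat \<Rightarrow> 'b::t1_space"
  assumes m: "0 < m" and n: "0 < n" and \<kappa>: "\<kappa> \<in> couplings (empirical m x) (empirical n y)"
  obtains \<pi> where "\<pi> \<in> plans m n" "\<And>f :: _ \<Rightarrow> real. f \<in> borel_measurable (borel \<Otimes>\<^sub>M borel) \<Longrightarrow>
    (\<integral>z. f z \<partial>\<kappa>) = plan_cost m n (\<lambda>i j. f (x i, y j)) \<pi>"
proof -
  interpret coupling "empirical m x" "empirical n y" \<kappa>
    by (rule coupling.intro prob_space_empirical[OF m] prob_space_empirical[OF n])+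
      (simp add: coupling_axioms_def \<kappa>)
  define U V where "U = x ` {..<m}" and "V = y ` {..<n}"
  have [simp]: "finite U" "finite V" by (auto simp: U_def V_def)
  define a where "a i = card {k. k < m \<and> x k = x i}" for i
  define b where "b j = card {k. k < n \<and> y k = y j}" for j
  have a: "a i \<noteq> 0" if "i < m" for i using that by (auto simp: a_def card_eq_0_iff)
  have b: "b j \<noteq> 0" if "j < n" for j using that by (auto simp: b_def card_eq_0_iff)
  define \<pi> where "\<pi> = (\<lambda>(i, j). measure \<kappa> {(x i, y j)} / a i / b j)"
  have sing: "{(u, v)} \<in> sets \<kappa>" for u v
  proof -
    have "{u} \<times> {v} \<in> sets (borel \<Otimes>\<^sub>M borel)" by (intro pair_measureI) simp_all
    thus ?thesis by (simp add: sets_eq cong: sets_pair_measure_cong)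
  qed
  \<comment> \<open>Both marginals live on finite sets, so \<kappa> is carried by finitely many
    atoms and its integrals are finite sums.\<close>
  have support: "AE z in \<kappa>. z \<in> U \<times> V"
    using AE_fst[OF AE_empirical[OF m]] AE_snd[OF AE_empirical[OF n]]
    by eventually_elim (auto simp: U_def V_def mem_Times_iff)
  have integral: "(\<integral>z. f z \<partial>\<kappa>) = (\<Sum>u\<in>U. \<Sum>v\<in>V. measure \<kappa> {(u, v)} * f (u, v))"
    if [measurable]: "f \<in> borel_measurable (borel \<Otimes>\<^sub>M borel)" for f :: "'a \<times> 'b \<Rightarrow> real"
  proof -
    have "f \<in> borel_measurable \<kappa>"
      using that by (simp add: measurable_cong_sets[OF sets_eq refl]
          measurable_cong_sets[OF sets_pair_measure_cong[OF sets_empirical sets_empirical] refl])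
    hence "(\<integral>z. f z \<partial>\<kappa>) = (\<integral>z. (\<Sum>p\<in>U \<times> V. indicator {p} z * f p) \<partial>\<kappa>)"
      using support sing
      by (intro integral_cong_AE borel_measurable_sum borel_measurable_times borel_measurable_indicator)
        (auto simp: indicator_def sum.If_cases elim!: eventually_mono split: prod.splits)
    also have "\<dots> = (\<Sum>p\<in>U \<times> V. measure \<kappa> {p} * f p)"
      using sing by (subst Bochner_Integration.integral_sum)
        (auto intro!: integrable_mult_left integrable_real_indicator sum.cong
          simp: emeasure_eq_measure dest: sets.sets_into_space)
    finally show ?thesis by (simp add: sum.cartesian_product split_beta)
  qed
  have cost: "(\<integral>z. f z \<partial>\<kappa>) = plan_cost m n (\<lambda>i j. f (x i, y j)) \<pi>"
    if "f \<in> borel_measurable (borel \<Otimes>\<^sub>M borel)" for f :: "'a \<times> 'b \<Rightarrow> real"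
  proof -
    have "plan_cost m n (\<lambda>i j. f (x i, y j)) \<pi> =
      (\<Sum>i<m. (\<Sum>j<n. measure \<kappa> {(x i, y j)} * f (x i, y j) / b j) / a i)"
      by (simp add: plan_cost_def \<pi>_def sum_divide_distrib field_simps)
    also have "\<dots> = (\<Sum>i<m. (\<Sum>v\<in>V. measure \<kappa> {(x i, v)} * f (x i, v)) / a i)"
      unfolding b_def V_def
      by (subst sum_div_multiplicity[of "\<lambda>v. measure \<kappa> {(x _, v)} * f (x _, v)"]) simp
    also have "\<dots> = (\<Sum>u\<in>U. \<Sum>v\<in>V. measure \<kappa> {(u, v)} * f (u, v))"
      unfolding a_def U_def
      by (rule sum_div_multiplicity[of "\<lambda>u. \<Sum>v\<in>V. measure \<kappa> {(u, v)} * f (u, v)"])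
    finally show ?thesis by (simp add: integral[OF that])
  qed
  have marginal_x: "measure (empirical m x) {x i} = a i / m" for i
    using emeasure_empirical[OF m, of "{x i}" x]
    by (simp add: measure_def a_def indicator_def sum.If_cases lessThan_def Collect_conj_eq)
  have marginal_y: "measure (empirical n y) {y j} = b j / n" for j
    using emeasure_empirical[OF n, of "{y j}" y]
    by (simp add: measure_def b_def indicator_def sum.If_cases lessThan_def Collect_conj_eq)
  have row: "(\<Sum>v\<in>V. measure \<kappa> {(x i, v)}) = a i / m" if i: "i < m" for i
  proof -
    have "a i / m = (\<integral>z. indicator {x i} (fst z) \<partial>\<kappa>)"
      by (subst integral_fst) (simp_all add: marginal_x)
    also have "\<dots> = (\<Sum>u\<in>U. \<Sum>v\<in>V. measure \<kappa> {(u, v)} * indicator {x i} u)"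
      by (subst integral) simp_all
    also have "\<dots> = (\<Sum>u\<in>{x i}. \<Sum>v\<in>V. measure \<kappa> {(u, v)} * indicator {x i} u)"
      using i by (intro sum.mono_neutral_right) (auto simp: U_def)
    finally show ?thesis by simp
  qed
  have column: "(\<Sum>u\<in>U. measure \<kappa> {(u, y j)}) = b j / n" if j: "j < n" for j
  proof -
    have "b j / n = (\<integral>z. indicator {y j} (snd z) \<partial>\<kappa>)"
      by (subst integral_snd) (simp_all add: marginal_y)
    also have "\<dots> = (\<Sum>u\<in>U. \<Sum>v\<in>V. measure \<kappa> {(u, v)} * indicator {y j} v)"
      by (subst integral) simp_all
    also have "\<dots> = (\<Sum>u\<in>U. \<Sum>v\<in>{y j}. measure \<kappa> {(u, v)} * indicator {y j} v)"
      using j by (intro sum.cong sum.mono_neutral_right) (auto simp: V_def)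
    finally show ?thesis by simp
  qed
  have "\<pi> \<in> plans m n"
    unfolding plans_def
  proof (intro CollectI conjI allI impI)
    fix i assume i: "i < m"
    have "(\<Sum>j<n. \<pi> (i, j)) = (\<Sum>j<n. measure \<kappa> {(x i, y j)} / b j) / a i"
      by (simp add: \<pi>_def sum_divide_distrib field_simps)
    also have "(\<Sum>j<n. measure \<kappa> {(x i, y j)} / b j) = a i / m"
      unfolding b_def using sum_div_multiplicity[of "\<lambda>v. measure \<kappa> {(x i, v)}" y n] row[OF i]
      by (simp add: V_def)
    finally show "(\<Sum>j<n. \<pi> (i, j)) = 1 / real m" using a[OF i] by simp
  next
    fix j assume j: "j < n"
    have "(\<Sum>i<m. \<pi> (i, j)) = (\<Sum>i<m. measure \<kappa> {(x i, y j)} / a i) / b j"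
      by (simp add: \<pi>_def sum_divide_distrib field_simps)
    also have "(\<Sum>i<m. measure \<kappa> {(x i, y j)} / a i) = b j / n"
      unfolding a_def using sum_div_multiplicity[of "\<lambda>u. measure \<kappa> {(u, y j)}" x m] column[OF j]
      by (simp add: U_def)
    finally show "(\<Sum>i<m. \<pi> (i, j)) = 1 / real n" using b[OF j] by simp
  qed (simp add: \<pi>_def)
  thus ?thesis using cost by (rule that)
qed

text \<open>This has the form that \<open>random_plan_coupling\<close> expects, with a one-point
  space of outcomes: a deterministic sample is a random one without randomness.\<close>

lemma emeasure_empirical_sum:
  assumes "0 < m" "A \<in> sets borel"
  shows "emeasure (empirical m x) A =
    (\<integral>\<^sup>+\<omega>. (\<Sum>i<m. ennreal (1 / real m) * indicator A (x i)) \<partial>count_space {()})"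
proof -
  have "(\<Sum>i<m. ennreal (1 / real m) * indicator A (x i)) = (\<Sum>i<m. ennreal (indicator A (x i) / real m))"
    by (intro sum.cong) (auto simp: indicator_def)
  also have "\<dots> = ennreal ((\<Sum>i<m. indicator A (x i)) / real m)"
    by (simp add: sum_divide_distrib)
  finally show ?thesis
    using assms by (simp add: emeasure_empirical nn_integral_count_space_finite)
qed

context lipschitz_score
begin

text \<open>The two infima range over the same set of real numbers: a coupling yields a plan of
  equal cost by splitting atoms, and a plan yields a coupling by \<open>random_plan_coupling\<close>
  on a one-point space.\<close>

lemma min_loss_empirical:
  assumes m: "0 < m" and n: "0 < n"
  shows "min_loss \<Lambda> s (empirical m x) (empirical n y) = ot_cost m n (\<lambda>i j. \<l> (x i) (y j))"
proof -
  have "(\<lambda>\<kappa>. \<integral>(x, y). \<l> x y \<partial>\<kappa>) ` couplings (empirical m x) (empirical n y) =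
      plan_cost m n (\<lambda>i j. \<l> (x i) (y j)) ` plans m n" (is "?A = ?B")
  proof (intro equalityI subsetI)
    fix r assume "r \<in> ?A"
    then obtain \<kappa> where \<kappa>: "\<kappa> \<in> couplings (empirical m x) (empirical n y)" and r: "r = (\<integral>(x, y). \<l> x y \<partial>\<kappa>)"
      by blast
    from empirical_coupling_plan[OF m n \<kappa>] obtain \<pi> where "\<pi> \<in> plans m n"
      "\<And>f :: _ \<Rightarrow> real. f \<in> borel_measurable (borel \<Otimes>\<^sub>M borel) \<Longrightarrow>
        (\<integral>z. f z \<partial>\<kappa>) = plan_cost m n (\<lambda>i j. f (x i, y j)) \<pi>" by blast
    thus "r \<in> ?B" using r loss_measurable by force
  next
    fix r assume "r \<in> ?B"
    then obtain \<pi> where \<pi>: "\<pi> \<in> plans m n" and r: "r = plan_cost m n (\<lambda>i j. \<l> (x i) (y j)) \<pi>"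
      by blast
    obtain \<kappa> where \<kappa>: "\<kappa> \<in> couplings (empirical m x) (empirical n y)"
      "\<And>c. c \<in> borel_measurable (borel \<Otimes>\<^sub>M borel) \<Longrightarrow> (\<And>z. 0 \<le> c z) \<Longrightarrow> (\<integral>\<^sup>+z. ennreal (c z) \<partial>\<kappa>) =
        (\<integral>\<^sup>+\<omega>. ennreal (plan_cost m n (\<lambda>i j. c (x i, y j)) \<pi>) \<partial>count_space {()})"
      by (rule random_plan_coupling[of "count_space {()}" m "\<lambda>i _. x i" n "\<lambda>j _. y j" "\<lambda>_. \<pi>"
          "empirical m x" "empirical n y"])
        (use \<pi> m n in \<open>auto simp: emeasure_empirical_sum intro: sigma_finite_measure_count_space_finite\<close>)
    have sets_\<kappa>: "sets \<kappa> = sets (borel \<Otimes>\<^sub>M borel)"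
      using \<kappa>(1) by (simp add: couplings_def cong: sets_pair_measure_cong)
    have "(\<integral>z. case_prod \<l> z \<partial>\<kappa>) = enn2real (\<integral>\<^sup>+z. ennreal (case_prod \<l> z) \<partial>\<kappa>)"
      using loss_measurable
      by (intro integral_eq_nn_integral) (auto simp: loss_nonneg measurable_cong_sets[OF sets_\<kappa> refl])
    also have "\<dots> = r"
      using \<pi> by (subst \<kappa>(2))
        (auto simp: r loss_nonneg nn_integral_count_space_finite plan_cost_nonneg split_beta)
    finally show "r \<in> ?A" using \<kappa>(1) by force
  qed
  thus ?thesis by (simp add: min_loss_def ot_cost_def)
qed

end

section \<open>Mixing plans over the sample\<close>

lemma emeasure_eq_average:
  assumes m: "0 < m" and X: "\<And>i. i < m \<Longrightarrow> X i \<in> borel_measurable M"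
    and distr: "\<And>i. i < m \<Longrightarrow> distr M borel (X i) = P" and A [measurable]: "A \<in> sets borel"
  shows "emeasure P A = (\<integral>\<^sup>+\<omega>. (\<Sum>i<m. ennreal (1 / real m) * indicator A (X i \<omega>)) \<partial>M)"
proof -
  note [measurable] = X
  have ind: "(\<integral>\<^sup>+\<omega>. indicator A (X i \<omega>) \<partial>M) = emeasure P A" if i: "i < m" for i
  proof -
    have "emeasure P A = (\<integral>\<^sup>+x. indicator A x \<partial>distr M borel (X i))"
      by (subst nn_integral_indicator) (simp, simp only: distr[OF i])
    also have "\<dots> = (\<integral>\<^sup>+\<omega>. indicator A (X i \<omega>) \<partial>M)"
      using i by (intro nn_integral_distr) simp_all
    finally show ?thesis ..
  qed
  have "(\<integral>\<^sup>+\<omega>. (\<Sum>i<m. ennreal (1 / real m) * indicator A (X i \<omega>)) \<partial>M) =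
      (\<Sum>i<m. \<integral>\<^sup>+\<omega>. ennreal (1 / real m) * indicator A (X i \<omega>) \<partial>M)"
    by (intro nn_integral_sum) measurable
  also have "\<dots> = (\<Sum>i<m. ennreal (1 / real m) * emeasure P A)"
    using ind by (intro sum.cong refl, subst nn_integral_cmult) auto
  also have "\<dots> = (\<Sum>i<m. ennreal (1 / real m)) * emeasure P A"
    by (rule sum_distrib_right[symmetric])
  also have "(\<Sum>i<m. ennreal (1 / real m)) = 1"
    using m by (subst sum_ennreal) auto
  finally show ?thesis by simp
qed

context score_problem
begin

text \<open>The empirical cost is biased upwards, which is the favourable direction for an upper
  confidence bound: no rate of convergence of empirical measures enters. Each plan spreads uniform
  weights over the observations, so the mixture has marginals \<open>P\<close> and \<open>Q\<close>;
  its cost exceeds the expected empirical one by at most \<epsilon>.\<close>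

lemma min_loss_le_expectation:
  assumes "prob_space M" and m: "0 < m" and n: "0 < n"
    and X [measurable]: "\<And>i. i < m \<Longrightarrow> X i \<in> borel_measurable M"
    and Y [measurable]: "\<And>j. j < n \<Longrightarrow> Y j \<in> borel_measurable M"
    and distr_X: "\<And>i. i < m \<Longrightarrow> distr M borel (X i) = P"
    and distr_Y: "\<And>j. j < n \<Longrightarrow> distr M borel (Y j) = Q"
  shows "min_loss \<Lambda> s P Q \<le> (\<integral>\<omega>. ot_cost m n (\<lambda>i j. \<l> (X i \<omega>) (Y j \<omega>)) \<partial>M)"
proof -
  interpret M: prob_space M by fact
  define c where "c \<omega> i j = \<l> (X i \<omega>) (Y j \<omega>)" for \<omega> i j
  have c [measurable]: "(\<lambda>\<omega>. c \<omega> i j) \<in> borel_measurable M" if "i < m" "j < n" for i j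
    using that unfolding c_def by measurable
  have c_nonneg: "0 \<le> c \<omega> i j" for \<omega> i j by (simp add: c_def loss_nonneg)
  have ot_nonneg: "0 \<le> ot_cost m n (c \<omega>)" for \<omega>
    by (intro ot_cost_nonneg m n c_nonneg)
  obtain T :: "nat \<Rightarrow> _" where T: "range T \<subseteq> plans m n"
    "\<forall>c. \<forall>\<pi>\<in>plans m n. \<forall>\<epsilon>>0. \<exists>k. plan_cost m n c (T k) < plan_cost m n c \<pi> + \<epsilon>"
    by (rule plans_dense_sequence[OF m n]) (rule that)
  have ot [measurable]: "(\<lambda>\<omega>. ot_cost m n (c \<omega>)) \<in> borel_measurable M"
    by (rule ot_cost_measurable[OF m n c_nonneg c])
  have int_c: "integrable M (\<lambda>\<omega>. c \<omega> i j)" if i: "i < m" and j: "j < n" for i j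
  proof -
    have "integrable M (\<lambda>\<omega>. norm (X i \<omega>))" "integrable M (\<lambda>\<omega>. norm (Y j \<omega>))"
      using integrable_distr[OF X[OF i], of norm] integrable_distr[OF Y[OF j], of norm]
        moment_P moment_Q distr_X[OF i] distr_Y[OF j] by auto
    hence *: "integrable M (\<lambda>\<omega>. K * norm (X i \<omega>) + K * norm (Y j \<omega>))" by simp
    have le: "norm (c \<omega> i j) \<le> norm (K * norm (X i \<omega>) + K * norm (Y j \<omega>))" for \<omega>
      using loss_le_norm[of "X i \<omega>" "Y j \<omega>"] loss_nonneg[of "X i \<omega>" "Y j \<omega>"] by (simp add: c_def)
    show ?thesis
      by (rule Bochner_Integration.integrable_bound[OF *]) (use i j in \<open>simp_all only: le c eventually_True\<close>)
  qed
  \<comment> \<open>The uniform plan is available for every outcome, and its integrable cost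
    dominates the optimal one.\<close>
  have "integrable M (\<lambda>\<omega>. plan_cost m n (c \<omega>) (\<lambda>_. 1 / (real m * real n)))"
    unfolding plan_cost_def by (intro Bochner_Integration.integrable_sum integrable_mult_right int_c) auto
  moreover have "norm (ot_cost m n (c \<omega>)) \<le> norm (plan_cost m n (c \<omega>) (\<lambda>_. 1 / (real m * real n)))" for \<omega>
    using ot_nonneg[of \<omega>] ot_cost_le[of m n "c \<omega>", OF c_nonneg uniform_plan[OF m n]] by simp
  ultimately have int_ot: "integrable M (\<lambda>\<omega>. ot_cost m n (c \<omega>))"
    by (rule Bochner_Integration.integrable_bound[OF _ ot AE_I2])
  have "min_loss \<Lambda> s P Q \<le> (\<integral>\<omega>. ot_cost m n (c \<omega>) \<partial>M) + \<epsilon>" if \<epsilon>: "0 < \<epsilon>" for \<epsilon>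
  proof -
    have ex: "\<exists>k. plan_cost m n (c \<omega>) (T k) < ot_cost m n (c \<omega>) + \<epsilon>" for \<omega>
    proof -
      have "(INF k. plan_cost m n (c \<omega>) (T k)) < ot_cost m n (c \<omega>) + \<epsilon>"
        using ot_cost_eq_INF_sequence[OF m n c_nonneg T(1) spec[OF T(2)]] \<epsilon> by simp
      from cInf_lessD[OF _ this] show ?thesis by auto
    qed
    \<comment> \<open>The least index of a sufficiently good plan is a measurable choice, because
      each of the countably many conditions compares measurable functions.\<close>
    define k where "k \<omega> = (LEAST k. plan_cost m n (c \<omega>) (T k) < ot_cost m n (c \<omega>) + \<epsilon>)" for \<omega>
    have k: "plan_cost m n (c \<omega>) (T (k \<omega>)) < ot_cost m n (c \<omega>) + \<epsilon>" for \<omega>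
      unfolding k_def using ex by (rule LeastI_ex)
    have [measurable]: "(\<lambda>\<omega>. plan_cost m n (c \<omega>) (T l)) \<in> borel_measurable M" for l
      unfolding plan_cost_def by measurable
    have k_meas [measurable]: "k \<in> M \<rightarrow>\<^sub>M count_space UNIV"
      unfolding k_def by measurable
    have marg_P: "emeasure P A = (\<integral>\<^sup>+\<omega>. (\<Sum>i<m. ennreal (1 / real m) * indicator A (X i \<omega>)) \<partial>M)"
      if "A \<in> sets borel" for A
      by (rule emeasure_eq_average[OF m X distr_X that])
    have marg_Q: "emeasure Q A = (\<integral>\<^sup>+\<omega>. (\<Sum>j<n. ennreal (1 / real n) * indicator A (Y j \<omega>)) \<partial>M)"
      if "A \<in> sets borel" for A
      by (rule emeasure_eq_average[OF n Y distr_Y that])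
    obtain \<kappa> where \<kappa>: "\<kappa> \<in> couplings P Q"
      "\<And>c. c \<in> borel_measurable (borel \<Otimes>\<^sub>M borel) \<Longrightarrow> (\<And>z. 0 \<le> c z) \<Longrightarrow> (\<integral>\<^sup>+z. ennreal (c z) \<partial>\<kappa>) =
        (\<integral>\<^sup>+\<omega>. ennreal (plan_cost m n (\<lambda>i j. c (X i \<omega>, Y j \<omega>)) (T (k \<omega>))) \<partial>M)"
      by (rule random_plan_coupling[OF M.sigma_finite_measure_axioms X Y _ _ sets_P marg_P sets_Q marg_Q,
          where W = "\<lambda>\<omega>. T (k \<omega>)"]) (use T(1) in auto)
    interpret coupled_scores \<Lambda> s L P Q \<kappa> by (rule coupled[OF \<kappa>(1)])
    have "ennreal (\<integral>z. \<l> (fst z) (snd z) \<partial>\<kappa>) = (\<integral>\<^sup>+z. ennreal (\<l> (fst z) (snd z)) \<partial>\<kappa>)"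
      using integrable_loss by (intro nn_integral_eq_integral[symmetric]) (auto simp: loss_nonneg)
    also have "\<dots> = (\<integral>\<^sup>+\<omega>. ennreal (plan_cost m n (c \<omega>) (T (k \<omega>))) \<partial>M)"
      by (subst \<kappa>(2)) (auto simp: loss_nonneg c_def[abs_def])
    also have "\<dots> \<le> (\<integral>\<^sup>+\<omega>. ennreal (ot_cost m n (c \<omega>) + \<epsilon>) \<partial>M)"
      using k by (intro nn_integral_mono ennreal_leI less_imp_le)
    also have "\<dots> = ennreal (\<integral>\<omega>. ot_cost m n (c \<omega>) + \<epsilon> \<partial>M)"
      using int_ot ot_nonneg \<epsilon> by (intro nn_integral_eq_integral) (auto simp: add_nonneg_pos less_imp_le)
    also have "(\<integral>\<omega>. ot_cost m n (c \<omega>) + \<epsilon> \<partial>M) = (\<integral>\<omega>. ot_cost m n (c \<omega>) \<partial>M) + \<epsilon>"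
      using int_ot by (simp add: M.prob_space)
    finally have "(\<integral>z. \<l> (fst z) (snd z) \<partial>\<kappa>) \<le> (\<integral>\<omega>. ot_cost m n (c \<omega>) \<partial>M) + \<epsilon>"
      using ot_nonneg \<epsilon> by (subst (asm) ennreal_le_iff) (auto intro!: add_nonneg_nonneg)
    thus ?thesis
      using min_loss_le[OF \<kappa>(1)] by (simp add: case_prod_beta')
  qed
  from field_le_epsilon[OF this] show ?thesis by (simp add: c_def[abs_def])
qed

end

section \<open>Concentration for two independent samples\<close>

text \<open>The hybrid \<open>h k\<close> takes its first \<open>k\<close> coordinates from
  \<open>x'\<close> and the rest from \<open>x\<close>. Consecutive hybrids differ in one
  coordinate, and the \<open>m\<close> differences telescope.\<close>

lemma hybrid_bounded_differences:
  fixes f :: "(nat \<Rightarrow> 'a) \<Rightarrow> real"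
  assumes diff: "\<And>x i a. x \<in> {..<m} \<rightarrow>\<^sub>E A \<Longrightarrow> i < m \<Longrightarrow> a \<in> A \<Longrightarrow> \<bar>f (x(i := a)) - f x\<bar> \<le> c"
    and x: "x \<in> {..<m} \<rightarrow>\<^sub>E A" and x': "x' \<in> {..<m} \<rightarrow>\<^sub>E A"
  shows "\<bar>f x' - f x\<bar> \<le> m * c"
proof -
  define h where "h k i = (if i < k then x' i else x i)" for k i
  have hE: "h k \<in> {..<m} \<rightarrow>\<^sub>E A" for k
    using x x' by (auto simp: h_def PiE_iff extensional_def)
  have "\<bar>f (h k) - f x\<bar> \<le> k * c" if "k \<le> m" for k
    using that
  proof (induction k)
    case 0
    show ?case by (simp add: h_def)
  next
    case (Suc k)
    have "h (Suc k) = (h k)(k := x' k)"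
      by (auto simp: h_def fun_eq_iff less_Suc_eq)
    hence "\<bar>f (h (Suc k)) - f (h k)\<bar> \<le> c"
      using diff[OF hE, of k "x' k" k] x' Suc.prems by (auto simp: PiE_iff)
    with Suc show ?case by (simp add: algebra_simps)
  qed
  moreover have "h m = x'"
    using x x' by (auto simp: h_def fun_eq_iff PiE_iff extensional_def)
  ultimately show ?thesis by force
qed

lemma average_update_diff:
  fixes f :: "'z \<Rightarrow> real"
  assumes "i < k" "\<bar>f a - f (x i)\<bar> \<le> c"
  shows "\<bar>(\<Sum>l<k. f ((x(i := a)) l)) / real k - (\<Sum>l<k. f (x l)) / real k\<bar> \<le> c / real k"
proof -
  have "(\<Sum>l<k. f ((x(i := a)) l)) - (\<Sum>l<k. f (x l)) = (\<Sum>l<k. f ((x(i := a)) l) - f (x l))"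
    by (simp add: sum_subtractf)
  also have "\<dots> = (\<Sum>l\<in>{i}. f ((x(i := a)) l) - f (x l))"
    using assms(1) by (intro sum.mono_neutral_right) auto
  finally have "(\<Sum>l<k. f ((x(i := a)) l)) / real k - (\<Sum>l<k. f (x l)) / real k = (f a - f (x i)) / real k"
    by (simp add: diff_divide_distrib[symmetric])
  thus ?thesis using assms by (simp add: abs_divide divide_right_mono)
qed

locale two_samples = prob_space M for M :: "'w measure" +
  fixes P Q :: "'a::topological_space measure" and A B :: "'a set" and m n :: nat
    and X Y :: "nat \<Rightarrow> 'w \<Rightarrow> 'a"
  assumes m: "0 < m" and n: "0 < n"
    and A [measurable]: "A \<in> sets borel" and P_A: "measure P A = 1"
    and B [measurable]: "B \<in> sets borel" and Q_B: "measure Q B = 1"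
    and indep_X: "indep_vars (\<lambda>_. borel) X {..<m}" and distr_X: "\<And>i. i < m \<Longrightarrow> distr M borel (X i) = P"
    and indep_Y: "indep_vars (\<lambda>_. borel) Y {..<n}" and distr_Y: "\<And>j. j < n \<Longrightarrow> distr M borel (Y j) = Q"
    and indep_XY: "indep_var (\<Pi>\<^sub>M i\<in>{..<m}. borel) (\<lambda>\<omega>. \<lambda>i\<in>{..<m}. X i \<omega>)
      (\<Pi>\<^sub>M j\<in>{..<n}. borel) (\<lambda>\<omega>. \<lambda>j\<in>{..<n}. Y j \<omega>)"
begin

lemma X_measurable [measurable]: "i < m \<Longrightarrow> X i \<in> borel_measurable M"
  and Y_measurable [measurable]: "j < n \<Longrightarrow> Y j \<in> borel_measurable M"
  using indep_X indep_Y unfolding indep_vars_def by blast+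

definition "sample \<omega> = (\<lambda>i\<in>{..<m}. X i \<omega>, \<lambda>j\<in>{..<n}. Y j \<omega>)"

abbreviation "sample_space \<equiv>
  (\<Pi>\<^sub>M i\<in>{..<m}. (borel :: 'a measure)) \<Otimes>\<^sub>M (\<Pi>\<^sub>M j\<in>{..<n}. (borel :: 'a measure))"

lemma sample_measurable [measurable]: "sample \<in> M \<rightarrow>\<^sub>M sample_space"
  unfolding sample_def by measurable

lemma prob_space_P: "prob_space P" and prob_space_Q: "prob_space Q"
  using prob_space_distr[OF X_measurable[OF m]] prob_space_distr[OF Y_measurable[OF n]]
    unfolding distr_X[OF m] distr_Y[OF n] .

lemma sets_P_borel: "sets P = sets borel" and sets_Q_borel: "sets Q = sets borel"
  using arg_cong[OF distr_X[OF m], of sets] arg_cong[OF distr_Y[OF n], of sets] by simp_all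

text \<open>Independence inside each sample makes the law of each block a product, and independence
  of the blocks makes the joint law the product of these two. This places the statistics in the
  setting of \<open>mcdiarmid_pair\<close>.\<close>

lemma distr_sample:
  "distr M sample_space sample = (\<Pi>\<^sub>M i\<in>{..<m}. P) \<Otimes>\<^sub>M (\<Pi>\<^sub>M j\<in>{..<n}. Q)"
proof -
  have "distr M (\<Pi>\<^sub>M i\<in>{..<m}. borel) (\<lambda>\<omega>. \<lambda>i\<in>{..<m}. X i \<omega>) = (\<Pi>\<^sub>M i\<in>{..<m}. distr M borel (X i))"
    using m indep_X by (subst indep_vars_iff_distr_eq_PiM'[symmetric]) auto
  also have "\<dots> = (\<Pi>\<^sub>M i\<in>{..<m}. P)"
    by (rule PiM_cong) (auto simp: distr_X)
  finally have 1: "distr M (\<Pi>\<^sub>M i\<in>{..<m}. borel) (\<lambda>\<omega>. \<lambda>i\<in>{..<m}. X i \<omega>) = (\<Pi>\<^sub>M i\<in>{..<m}. P)" .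
  have "distr M (\<Pi>\<^sub>M j\<in>{..<n}. borel) (\<lambda>\<omega>. \<lambda>j\<in>{..<n}. Y j \<omega>) = (\<Pi>\<^sub>M j\<in>{..<n}. distr M borel (Y j))"
    using n indep_Y by (subst indep_vars_iff_distr_eq_PiM'[symmetric]) auto
  also have "\<dots> = (\<Pi>\<^sub>M j\<in>{..<n}. Q)"
    by (rule PiM_cong) (auto simp: distr_Y)
  finally have 2: "distr M (\<Pi>\<^sub>M j\<in>{..<n}. borel) (\<lambda>\<omega>. \<lambda>j\<in>{..<n}. Y j \<omega>) = (\<Pi>\<^sub>M j\<in>{..<n}. Q)" .
  show ?thesis
    using indep_XY unfolding indep_var_distribution_eq 1 2 sample_def[abs_def] by simp
qed

lemma AE_P: "AE x in P. x \<in> A" and AE_Q: "AE y in Q. y \<in> B"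
  using prob_space.AE_prob_1[OF prob_space_P P_A] prob_space.AE_prob_1[OF prob_space_Q Q_B] .

lemma AE_sample: "AE \<omega> in M. (\<forall>i<m. X i \<omega> \<in> A) \<and> (\<forall>j<n. Y j \<omega> \<in> B)"
proof -
  have "AE \<omega> in M. X i \<omega> \<in> A" if "i < m" for i
    using AE_distrD[OF X_measurable[OF that], of "\<lambda>x. x \<in> A"] AE_P unfolding distr_X[OF that] .
  moreover have "AE \<omega> in M. Y j \<omega> \<in> B" if "j < n" for j
    using AE_distrD[OF Y_measurable[OF that], of "\<lambda>y. y \<in> B"] AE_Q unfolding distr_Y[OF that] .
  ultimately show ?thesis
    by (auto simp: AE_all_countable AE_conj_iff intro!: AE_ball_countable'[where I = "{..<m}", simplified]
        AE_ball_countable'[where I = "{..<n}", simplified])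
qed

lemma sample_in: "(\<forall>i<m. X i \<omega> \<in> A) \<and> (\<forall>j<n. Y j \<omega> \<in> B) \<Longrightarrow>
    sample \<omega> \<in> ({..<m} \<rightarrow>\<^sub>E A) \<times> ({..<n} \<rightarrow>\<^sub>E B)"
  by (auto simp: sample_def)

context
  fixes F :: "(nat \<Rightarrow> 'a) \<times> (nat \<Rightarrow> 'a) \<Rightarrow> real" and c d :: real
  assumes F [measurable]: "F \<in> borel_measurable sample_space"
    and diff_A: "\<And>x y i a. x \<in> {..<m} \<rightarrow>\<^sub>E A \<Longrightarrow> y \<in> {..<n} \<rightarrow>\<^sub>E B \<Longrightarrow> i < m \<Longrightarrow> a \<in> A \<Longrightarrow>
      \<bar>F (x(i := a), y) - F (x, y)\<bar> \<le> c / m"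
    and diff_B: "\<And>x y j b. x \<in> {..<m} \<rightarrow>\<^sub>E A \<Longrightarrow> y \<in> {..<n} \<rightarrow>\<^sub>E B \<Longrightarrow> j < n \<Longrightarrow> b \<in> B \<Longrightarrow>
      \<bar>F (x, y(j := b)) - F (x, y)\<bar> \<le> d / n"
begin

lemma bounded_differences_osc:
  assumes x: "x \<in> {..<m} \<rightarrow>\<^sub>E A" "x' \<in> {..<m} \<rightarrow>\<^sub>E A" and y: "y \<in> {..<n} \<rightarrow>\<^sub>E B" "y' \<in> {..<n} \<rightarrow>\<^sub>E B"
  shows "\<bar>F (x', y') - F (x, y)\<bar> \<le> c + d"
proof -
  have "\<bar>F (x', y') - F (x, y')\<bar> \<le> m * (c / m)"
    using hybrid_bounded_differences[of m A "\<lambda>x. F (x, y')" "c / m", OF diff_A x] y by simp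
  moreover have "\<bar>F (x, y') - F (x, y)\<bar> \<le> n * (d / n)"
    using hybrid_bounded_differences[of n B "\<lambda>y. F (x, y)" "d / n", OF diff_B y] x by simp
  ultimately show ?thesis using m n by simp
qed

text \<open>The difference bounds for \<open>F\<close> hold only while all coordinates stay in
  \<open>A\<close> and \<open>B\<close>, whereas \<open>mcdiarmid_pair\<close> asks for them on the
  whole product space. It is applied to a modification \<open>f\<close> of \<open>F\<close> that
  satisfies them everywhere and agrees with \<open>F\<close> almost surely along the sample.\<close>

lemma mcdiarmid:
  assumes V: "0 < c\<^sup>2 / m + d\<^sup>2 / n" and \<epsilon>: "0 < \<epsilon>"
  shows "prob {\<omega> \<in> space M. F (sample \<omega>) \<ge> expectation (\<lambda>\<omega>. F (sample \<omega>)) + \<epsilon>}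
    \<le> exp (- 2 * \<epsilon>\<^sup>2 / (c\<^sup>2 / m + d\<^sup>2 / n))"
proof -
  obtain a0 b0 where a0: "a0 \<in> A" and b0: "b0 \<in> B"
    using P_A Q_B by fastforce
  define N where "N = (\<Pi>\<^sub>M i\<in>{..<m}. P) \<Otimes>\<^sub>M (\<Pi>\<^sub>M j\<in>{..<n}. Q)"
  have setsN: "sets N = sets sample_space"
    unfolding N_def by (intro sets_pair_measure_cong sets_PiM_cong refl sets_P_borel sets_Q_borel)
  have spaceN: "space N = ({..<m} \<rightarrow>\<^sub>E UNIV) \<times> ({..<n} \<rightarrow>\<^sub>E UNIV)"
    using sets_eq_imp_space_eq[OF setsN] by (simp add: space_pair_measure space_PiM)
  \<comment> \<open>Retractions of the space onto \<open>A\<close> and \<open>B\<close>: points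
    outside go to the fixed \<open>a0\<close> and \<open>b0\<close>. They act coordinatewise, so
    changing one coordinate before retracting changes at most one coordinate after.\<close>
  define p where "p a = (if a \<in> A then a else a0)" for a
  define q where "q b = (if b \<in> B then b else b0)" for b
  have [measurable]: "p \<in> borel_measurable borel" "q \<in> borel_measurable borel"
    unfolding p_def q_def by measurable
  define R where "R = (\<lambda>(x, y). (\<lambda>i\<in>{..<m}. p (x i :: 'a), \<lambda>j\<in>{..<n}. q (y j :: 'a)))"
  have R [measurable]: "R \<in> sample_space \<rightarrow>\<^sub>M sample_space"
    unfolding R_def by measurable
  define f where "f z = F (R z)" for z
  have f [measurable]: "f \<in> borel_measurable sample_space"
    unfolding f_def by measurable
  have Rx: "(\<lambda>i\<in>{..<m}. p (x i)) \<in> {..<m} \<rightarrow>\<^sub>E A" for x using a0 by (auto simp: p_def)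
  have Ry: "(\<lambda>j\<in>{..<n}. q (y j)) \<in> {..<n} \<rightarrow>\<^sub>E B" for y using b0 by (auto simp: q_def)
  have upd_x: "(\<lambda>i\<in>{..<m}. p ((x(k := a)) i)) = (\<lambda>i\<in>{..<m}. p (x i))(k := p a)" if "k < m" for x k a
    using that by (auto simp: fun_eq_iff restrict_def)
  have upd_y: "(\<lambda>j\<in>{..<n}. q ((y(k := b)) j)) = (\<lambda>j\<in>{..<n}. q (y j))(k := q b)" if "k < n" for y k b
    using that by (auto simp: fun_eq_iff restrict_def)
  have pq: "p a \<in> A" "q b \<in> B" for a b using a0 b0 by (auto simp: p_def q_def)
  have tail: "measure N {z \<in> space N. f z \<ge> (\<integral>z. f z \<partial>N) + \<epsilon>} \<le> exp (- 2 * \<epsilon>\<^sup>2 / (c\<^sup>2 / m + d\<^sup>2 / n))"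
    unfolding N_def
  \<comment> \<open>The bound on \<open>f\<close> is its value at a reference point plus the total
    oscillation \<open>c + d\<close>. Since \<open>m\<close> increments of size \<open>c / m\<close>
    have squares summing to \<open>c\<^sup>2 / m\<close>, the variance term takes its familiar
    form.\<close>
  proof (rule mcdiarmid_pair[where C = "\<bar>f (\<lambda>_. a0, \<lambda>_. b0)\<bar> + (c + d)" and c = "\<lambda>_. c / m" and d = "\<lambda>_. d / n"])
    show "f \<in> borel_measurable ((\<Pi>\<^sub>M i\<in>{..<m}. P) \<Otimes>\<^sub>M (\<Pi>\<^sub>M j\<in>{..<n}. Q))"
      using f by (simp add: measurable_cong_sets[OF setsN[unfolded N_def] refl])
    show "\<bar>f z\<bar> \<le> \<bar>f (\<lambda>_. a0, \<lambda>_. b0)\<bar> + (c + d)" for z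
      using bounded_differences_osc[OF Rx[of "\<lambda>_. a0"] Rx[of "fst z"] Ry[of "\<lambda>_. b0"] Ry[of "snd z"]]
      by (simp add: f_def R_def split_beta)
    show "\<bar>f (x(i := a), y) - f (x, y)\<bar> \<le> c / m" if "i \<in> {..<m}" for x y i a
      using that diff_A[OF Rx Ry, of i "p a" x y] pq
      unfolding f_def R_def prod.case by (simp only: upd_x lessThan_iff)
    show "\<bar>f (x, y(j := b)) - f (x, y)\<bar> \<le> d / n" if "j \<in> {..<n}" for x y j b
      using that diff_B[OF Rx Ry, of j "q b" x y] pq
      unfolding f_def R_def prod.case by (simp only: upd_y lessThan_iff)
    show "c\<^sup>2 / m + d\<^sup>2 / n = (\<Sum>i<m. (c / m)\<^sup>2) + (\<Sum>j<n. (d / n)\<^sup>2)"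
      using m n by (simp add: power_divide power2_eq_square)
  qed (use V \<epsilon> prob_space_P prob_space_Q in auto)
  have eq: "AE \<omega> in M. f (sample \<omega>) = F (sample \<omega>)"
    using AE_sample
  proof eventually_elim
    case (elim \<omega>)
    hence "R (sample \<omega>) = sample \<omega>"
      by (auto simp: R_def sample_def p_def q_def fun_eq_iff)
    thus ?case by (simp add: f_def)
  qed
  have E: "(\<integral>z. f z \<partial>N) = expectation (\<lambda>\<omega>. F (sample \<omega>))"
    unfolding N_def distr_sample[symmetric]
    by (subst integral_distr) (use eq in \<open>auto intro!: integral_cong_AE\<close>)
  define S where "S = {z \<in> space N. f z \<ge> expectation (\<lambda>\<omega>. F (sample \<omega>)) + \<epsilon>}"
  have S: "S \<in> sets sample_space"
    unfolding S_def sets_eq_imp_space_eq[OF setsN] by measurable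
  have "prob {\<omega> \<in> space M. F (sample \<omega>) \<ge> expectation (\<lambda>\<omega>. F (sample \<omega>)) + \<epsilon>} =
      prob (sample -` S \<inter> space M)"
    by (intro measure_eq_AE measurable_sets[OF sample_measurable S])
      (use eq measurable_space[OF sample_measurable] sets_eq_imp_space_eq[OF setsN]
        in \<open>auto simp: S_def elim!: eventually_mono\<close>)
  also have "\<dots> = measure N S"
    unfolding N_def distr_sample[symmetric] using S by (simp add: measure_distr)
  finally show ?thesis using tail by (simp add: E S_def)
qed

text \<open>The threshold solves \<open>exp (- 2 * \<epsilon>\<^sup>2 / v) = \<delta> / 2\<close>.
  The event includes equality, so the complementary bound is strict.\<close>

lemma mcdiarmid_level_ge:
  assumes \<delta>: "0 < \<delta>" "\<delta> < 1" and V: "0 < c\<^sup>2 / m + d\<^sup>2 / n"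
  shows "prob {\<omega> \<in> space M. F (sample \<omega>) \<ge> expectation (\<lambda>\<omega>. F (sample \<omega>)) +
    sqrt (ln (2 / \<delta>) / 2 * (c\<^sup>2 / m + d\<^sup>2 / n))} \<le> \<delta> / 2"
proof -
  have ln: "0 < ln (2 / \<delta>)" using \<delta> by (intro ln_gt_zero) simp
  define v where "v = c\<^sup>2 / m + d\<^sup>2 / n"
  have v: "0 < v" using V by (simp add: v_def)
  define \<epsilon> where "\<epsilon> = sqrt (ln (2 / \<delta>) / 2 * v)"
  have "- 2 * \<epsilon>\<^sup>2 / v = - ln (2 / \<delta>)"
    using ln v by (simp add: \<epsilon>_def)
  hence "exp (- 2 * \<epsilon>\<^sup>2 / v) = \<delta> / 2"
    using \<delta> by (simp add: exp_minus)
  moreover have "0 < \<epsilon>" using ln v by (simp add: \<epsilon>_def)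
  ultimately show ?thesis using mcdiarmid[OF V, of \<epsilon>] by (simp add: \<epsilon>_def v_def)
qed

text \<open>With zero variance the threshold is the mean and \<open>F\<close> is almost surely
  constant, so the event with equality would have probability 1. The strict event is null, and so
  the bound survives in the degenerate case.\<close>

lemma mcdiarmid_level_gt:
  assumes \<delta>: "0 < \<delta>" "\<delta> < 1"
  shows "prob {\<omega> \<in> space M. F (sample \<omega>) > expectation (\<lambda>\<omega>. F (sample \<omega>)) +
    sqrt (ln (2 / \<delta>) / 2 * (c\<^sup>2 / m + d\<^sup>2 / n))} \<le> \<delta> / 2" (is "prob ?G \<le> _")
proof (cases "0 < c\<^sup>2 / m + d\<^sup>2 / n")
  case True
  have "prob ?G \<le> prob {\<omega> \<in> space M. F (sample \<omega>) \<ge> expectation (\<lambda>\<omega>. F (sample \<omega>)) +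
      sqrt (ln (2 / \<delta>) / 2 * (c\<^sup>2 / m + d\<^sup>2 / n))}"
    by (intro finite_measure_mono) auto
  also have "\<dots> \<le> \<delta> / 2" by (rule mcdiarmid_level_ge[OF \<delta> True])
  finally show ?thesis .
next
  case False
  have "c\<^sup>2 / m + d\<^sup>2 / n = 0"
    using False by (intro antisym) (auto simp: not_less)
  hence "c\<^sup>2 / m = 0 \<and> d\<^sup>2 / n = 0"
    by (subst (asm) add_nonneg_eq_0_iff) auto
  hence cd: "c = 0" "d = 0" using m n by auto
  obtain a0 b0 where a0: "a0 \<in> A" and b0: "b0 \<in> B"
    using P_A Q_B by fastforce
  define r where "r = F (\<lambda>i\<in>{..<m}. a0, \<lambda>j\<in>{..<n}. b0)"
  have const: "AE \<omega> in M. F (sample \<omega>) = r"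
    using AE_sample
  proof eventually_elim
    case (elim \<omega>)
    have "\<bar>F (fst (sample \<omega>), snd (sample \<omega>)) - r\<bar> \<le> c + d"
      unfolding r_def using sample_in[OF elim] a0 b0
      by (intro bounded_differences_osc) (auto simp: mem_Times_iff)
    thus ?case by (simp add: cd)
  qed
  have "expectation (\<lambda>\<omega>. F (sample \<omega>)) = expectation (\<lambda>_. r)"
    using const by (intro integral_cong_AE) auto
  hence "expectation (\<lambda>\<omega>. F (sample \<omega>)) = r" by (simp add: prob_space)
  with const have "AE \<omega> in M. \<omega> \<notin> ?G" by (auto simp: cd elim!: eventually_mono)
  hence "prob ?G = prob {}" by (intro measure_eq_AE) auto
  thus ?thesis using \<delta> by simp
qed

end

end

section \<open>Confidence bounds for the minimal loss and the score difference\<close>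

locale score_samples = score_problem \<Lambda> s L P Q + two_samples M P Q A B m n X Y
  for \<Lambda> :: "'t measure" and s :: "'t \<Rightarrow> real ^ 'd \<Rightarrow> real" and L and P Q :: "(real ^ 'd) measure"
    and M :: "'w measure" and A B m n X Y +
  fixes \<delta> :: real
  assumes \<delta>: "0 < \<delta>" "\<delta> < 1"
    and bdd_loss_A: "bdd_above ((\<lambda>(x, x', y). \<bar>loss \<Lambda> s x y - loss \<Lambda> s x' y\<bar>) ` (A \<times> A \<times> B))"
    and bdd_loss_B: "bdd_above ((\<lambda>(x, y, y'). \<bar>loss \<Lambda> s x y - loss \<Lambda> s x y'\<bar>) ` (A \<times> B \<times> B))"
    and bdd_score_A: "bdd_above ((\<lambda>(x, x'). \<bar>mean_score \<Lambda> s x - mean_score \<Lambda> s x'\<bar>) ` (A \<times> A))"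
    and bdd_score_B: "bdd_above ((\<lambda>(y, y'). \<bar>mean_score \<Lambda> s y - mean_score \<Lambda> s y'\<bar>) ` (B \<times> B))"
begin

lemma loss_osc_A: "x \<in> A \<Longrightarrow> x' \<in> A \<Longrightarrow> y \<in> B \<Longrightarrow> \<bar>\<l> x y - \<l> x' y\<bar> \<le> loss_osc_P \<Lambda> s A B"
  unfolding loss_osc_P_def by (rule cSUP_upper2[OF bdd_loss_A, of "(x, x', y)"]) auto

lemma loss_osc_B: "x \<in> A \<Longrightarrow> y \<in> B \<Longrightarrow> y' \<in> B \<Longrightarrow> \<bar>\<l> x y - \<l> x y'\<bar> \<le> loss_osc_Q \<Lambda> s A B"
  unfolding loss_osc_Q_def by (rule cSUP_upper2[OF bdd_loss_B, of "(x, y, y')"]) auto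

lemma score_osc_A: "x \<in> A \<Longrightarrow> x' \<in> A \<Longrightarrow> \<bar>S x - S x'\<bar> \<le> score_osc \<Lambda> s A"
  unfolding score_osc_def by (rule cSUP_upper2[OF bdd_score_A, of "(x, x')"]) auto

lemma score_osc_B: "y \<in> B \<Longrightarrow> y' \<in> B \<Longrightarrow> \<bar>S y - S y'\<bar> \<le> score_osc \<Lambda> s B"
  unfolding score_osc_def by (rule cSUP_upper2[OF bdd_score_B, of "(y, y')"]) auto

abbreviation "upper \<omega> \<equiv> loss_upper \<Lambda> s A B \<delta> m n (\<lambda>i. X i \<omega>) (\<lambda>j. Y j \<omega>)"
abbreviation "lower \<omega> \<equiv> diff_lower \<Lambda> s A B \<delta> m n (\<lambda>i. X i \<omega>) (\<lambda>j. Y j \<omega>)"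

text \<open>The sign is reversed because the available tail bound is for upward deviations, while
  the loss bound fails when the empirical cost is too small.\<close>

definition "neg_ot = (\<lambda>(x, y). - ot_cost m n (\<lambda>i j. \<l> (x i) (y j)))"

definition "score_diff = (\<lambda>(x, y). emp_diff \<Lambda> s m n x y)"

lemma neg_ot_sample: "neg_ot (sample \<omega>) = - ot_cost m n (\<lambda>i j. \<l> (X i \<omega>) (Y j \<omega>))"
  unfolding neg_ot_def sample_def prod.case
  by (rule arg_cong[OF ot_cost_cong]) simp

lemma score_diff_sample: "score_diff (sample \<omega>) = emp_diff \<Lambda> s m n (\<lambda>i. X i \<omega>) (\<lambda>j. Y j \<omega>)"
  by (simp add: score_diff_def sample_def emp_diff_def)

lemma neg_ot_measurable [measurable]: "neg_ot \<in> borel_measurable sample_space"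
  unfolding neg_ot_def case_prod_beta'
  by (intro borel_measurable_uminus ot_cost_measurable m n loss_nonneg) measurable

lemma score_diff_measurable [measurable]: "score_diff \<in> borel_measurable sample_space"
  unfolding score_diff_def case_prod_beta' emp_diff_def by measurable

lemma neg_ot_diff_A:
  assumes "x \<in> {..<m} \<rightarrow>\<^sub>E A" "y \<in> {..<n} \<rightarrow>\<^sub>E B" "i < m" "a \<in> A"
  shows "\<bar>neg_ot (x(i := a), y) - neg_ot (x, y)\<bar> \<le> loss_osc_P \<Lambda> s A B / m"
proof -
  have "\<bar>ot_cost m n (\<lambda>k j. \<l> ((x(i := a)) k) (y j)) - ot_cost m n (\<lambda>k j. \<l> (x k) (y j))\<bar>
      \<le> loss_osc_P \<Lambda> s A B / m"
    using assms
    by (intro ot_cost_diff_le m n loss_nonneg plan_cost_row_diff[where i = i])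
      (auto intro!: loss_osc_A simp: PiE_iff)
  thus ?thesis by (simp add: neg_ot_def)
qed

lemma neg_ot_diff_B:
  assumes "x \<in> {..<m} \<rightarrow>\<^sub>E A" "y \<in> {..<n} \<rightarrow>\<^sub>E B" "j < n" "b \<in> B"
  shows "\<bar>neg_ot (x, y(j := b)) - neg_ot (x, y)\<bar> \<le> loss_osc_Q \<Lambda> s A B / n"
proof -
  have "\<bar>ot_cost m n (\<lambda>i k. \<l> (x i) ((y(j := b)) k)) - ot_cost m n (\<lambda>i k. \<l> (x i) (y k))\<bar>
      \<le> loss_osc_Q \<Lambda> s A B / n"
    using assms
    by (intro ot_cost_diff_le m n loss_nonneg plan_cost_column_diff[where j = j])
      (auto intro!: loss_osc_B simp: PiE_iff)
  thus ?thesis by (simp add: neg_ot_def)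
qed

lemma score_diff_diff_A:
  assumes "x \<in> {..<m} \<rightarrow>\<^sub>E A" "y \<in> {..<n} \<rightarrow>\<^sub>E B" "i < m" "a \<in> A"
  shows "\<bar>score_diff (x(i := a), y) - score_diff (x, y)\<bar> \<le> score_osc \<Lambda> s A / m"
proof -
  have "\<bar>S a - S (x i)\<bar> \<le> score_osc \<Lambda> s A"
    using assms by (intro score_osc_A) (auto simp: PiE_iff)
  from average_update_diff[of i m S a x, OF assms(3) this] show ?thesis
    unfolding score_diff_def emp_diff_def prod.case by linarith
qed

lemma score_diff_diff_B:
  assumes "x \<in> {..<m} \<rightarrow>\<^sub>E A" "y \<in> {..<n} \<rightarrow>\<^sub>E B" "j < n" "b \<in> B"
  shows "\<bar>score_diff (x, y(j := b)) - score_diff (x, y)\<bar> \<le> score_osc \<Lambda> s B / n"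
proof -
  have "\<bar>S b - S (y j)\<bar> \<le> score_osc \<Lambda> s B"
    using assms by (intro score_osc_B) (auto simp: PiE_iff)
  from average_update_diff[of j n S b y, OF assms(3) this] show ?thesis
    unfolding score_diff_def emp_diff_def prod.case by linarith
qed

text \<open>An inequality suffices here: when \<open>upper\<close> falls below the true minimal
  loss, the empirical cost falls below its own, possibly larger, mean by more than the
  margin.\<close>

lemma expectation_neg_ot: "expectation (\<lambda>\<omega>. neg_ot (sample \<omega>)) \<le> - min_loss \<Lambda> s P Q"
  using min_loss_le_expectation[OF prob_space_axioms m n X_measurable Y_measurable distr_X distr_Y]
  by (simp add: neg_ot_sample)

lemma expectation_score_diff: "expectation (\<lambda>\<omega>. score_diff (sample \<omega>)) = \<Delta>"
proof -
  have S: "integrable P S" "integrable Q S"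
    using moment_P moment_Q sets_P sets_Q P.finite_measure_axioms Q.finite_measure_axioms
    by (auto intro: integrable_mean_score)
  have X: "integrable M (\<lambda>\<omega>. S (X i \<omega>))" "expectation (\<lambda>\<omega>. S (X i \<omega>)) = (\<integral>x. S x \<partial>P)" if "i < m" for i
    using that integrable_distr[OF X_measurable[OF that], of S] S
      integral_distr[OF X_measurable[OF that], of S]
    by (simp_all add: distr_X[OF that])
  have Y: "integrable M (\<lambda>\<omega>. S (Y j \<omega>))" "expectation (\<lambda>\<omega>. S (Y j \<omega>)) = (\<integral>y. S y \<partial>Q)" if "j < n" for j
    using that integrable_distr[OF Y_measurable[OF that], of S] S
      integral_distr[OF Y_measurable[OF that], of S]
    by (simp_all add: distr_Y[OF that])
  have "expectation (\<lambda>\<omega>. score_diff (sample \<omega>)) =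
      expectation (\<lambda>\<omega>. (\<Sum>j<n. S (Y j \<omega>)) / real n) - expectation (\<lambda>\<omega>. (\<Sum>i<m. S (X i \<omega>)) / real m)"
    unfolding score_diff_sample emp_diff_def
    by (intro Bochner_Integration.integral_diff integrable_divide Bochner_Integration.integrable_sum X Y) auto
  also have "expectation (\<lambda>\<omega>. (\<Sum>j<n. S (Y j \<omega>)) / real n) = (\<integral>y. S y \<partial>Q)"
    using Y n by (subst integral_divide_zero, subst Bochner_Integration.integral_sum) auto
  also have "expectation (\<lambda>\<omega>. (\<Sum>i<m. S (X i \<omega>)) / real m) = (\<integral>x. S x \<partial>P)"
    using X m by (subst integral_divide_zero, subst Bochner_Integration.integral_sum) auto
  finally show ?thesis by (simp add: \<Delta>_def)
qed

abbreviation "loss_var \<equiv> (loss_osc_P \<Lambda> s A B)\<^sup>2 / m + (loss_osc_Q \<Lambda> s A B)\<^sup>2 / n"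

lemma upper_eq: "upper \<omega> = - neg_ot (sample \<omega>) + sqrt (ln (2 / \<delta>) / 2 * loss_var)"
  by (simp add: loss_upper_def min_loss_empirical[OF m n] neg_ot_sample)

lemma lower_eq: "lower \<omega> = score_diff (sample \<omega>) -
    sqrt (ln (2 / \<delta>) / 2 * ((score_osc \<Lambda> s A)\<^sup>2 / m + (score_osc \<Lambda> s B)\<^sup>2 / n))"
  by (simp add: diff_lower_def score_diff_sample)

lemma upper_measurable [measurable]: "upper \<in> borel_measurable M"
  unfolding upper_eq[abs_def] by measurable

lemma lower_measurable [measurable]: "lower \<in> borel_measurable M"
  unfolding lower_eq[abs_def] by measurable

lemma prob_upper_less: "prob {\<omega> \<in> space M. upper \<omega> < min_loss \<Lambda> s P Q} \<le> \<delta> / 2"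
proof -
  have "prob {\<omega> \<in> space M. upper \<omega> < min_loss \<Lambda> s P Q} \<le> prob {\<omega> \<in> space M.
      neg_ot (sample \<omega>) > expectation (\<lambda>\<omega>. neg_ot (sample \<omega>)) + sqrt (ln (2 / \<delta>) / 2 * loss_var)}"
    (is "prob ?G \<le> prob ?H")
  proof (rule finite_measure_mono)
    show "?G \<subseteq> ?H"
      using expectation_neg_ot unfolding upper_eq by (intro Collect_mono) linarith
    show "?H \<in> sets M" by measurable
  qed
  also have "\<dots> \<le> \<delta> / 2"
    by (rule mcdiarmid_level_gt) (assumption | rule neg_ot_measurable neg_ot_diff_A neg_ot_diff_B \<delta>)+
  finally show ?thesis .
qed

text \<open>Excluding equality as well costs no extra probability when the variance term is
  positive. This supplies the strict inequality from which a coupling is extracted.\<close>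

lemma prob_upper_le:
  assumes "0 < loss_var"
  shows "prob {\<omega> \<in> space M. upper \<omega> \<le> min_loss \<Lambda> s P Q} \<le> \<delta> / 2"
proof -
  have "prob {\<omega> \<in> space M. upper \<omega> \<le> min_loss \<Lambda> s P Q} \<le> prob {\<omega> \<in> space M.
      neg_ot (sample \<omega>) \<ge> expectation (\<lambda>\<omega>. neg_ot (sample \<omega>)) + sqrt (ln (2 / \<delta>) / 2 * loss_var)}"
    (is "prob ?G \<le> prob ?H")
  proof (rule finite_measure_mono)
    show "?G \<subseteq> ?H"
      using expectation_neg_ot unfolding upper_eq by (intro Collect_mono) linarith
    show "?H \<in> sets M" by measurable
  qed
  also have "\<dots> \<le> \<delta> / 2"
    by (rule mcdiarmid_level_ge) (assumption | rule neg_ot_measurable neg_ot_diff_A neg_ot_diff_B \<delta> assms)+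
  finally show ?thesis .
qed

lemma prob_lower_greater: "prob {\<omega> \<in> space M. \<Delta> < lower \<omega>} \<le> \<delta> / 2"
proof -
  have "{\<omega> \<in> space M. \<Delta> < lower \<omega>} = {\<omega> \<in> space M. score_diff (sample \<omega>) >
      expectation (\<lambda>\<omega>. score_diff (sample \<omega>)) +
      sqrt (ln (2 / \<delta>) / 2 * ((score_osc \<Lambda> s A)\<^sup>2 / m + (score_osc \<Lambda> s B)\<^sup>2 / n))}"
    unfolding expectation_score_diff lower_eq by (intro Collect_cong conj_cong refl) linarith
  also have "prob \<dots> \<le> \<delta> / 2"
    by (rule mcdiarmid_level_gt) (assumption | rule score_diff_measurable score_diff_diff_A score_diff_diff_B \<delta>)+
  finally show ?thesis .
qed

section \<open>The simultaneous bound and the false certification bound\<close>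

abbreviation "gap \<omega> \<equiv> gap_upper \<Lambda> s A B \<delta> m n (\<lambda>i. X i \<omega>) (\<lambda>j. Y j \<omega>)"

lemma gap_eq: "gap \<omega> \<gamma> = (1 - \<gamma>) * upper \<omega> - \<gamma> * lower \<omega>"
  by (rule gap_upper_def)

lemma gap_bound:
  assumes \<gamma>: "\<gamma> \<in> {0..1}" and "min_loss \<Lambda> s P Q \<le> upper \<omega>" "lower \<omega> \<le> \<Delta>"
  shows "csd_gap \<Lambda> s \<gamma> P Q \<le> gap \<omega> \<gamma>"
  unfolding csd_gap_eq[OF \<gamma>] gap_eq using assms by (intro diff_mono mult_left_mono) auto

text \<open>Both sides are affine in \<gamma>, so the endpoints decide: \<gamma> = 0 compares the
  losses and \<gamma> = 1 the score differences. The uncountable quantifier thereby becomes a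
  measurable event.\<close>

lemma gap_bound_all_iff:
  "(\<forall>\<gamma>\<in>{0..1}. csd_gap \<Lambda> s \<gamma> P Q \<le> gap \<omega> \<gamma>) \<longleftrightarrow> min_loss \<Lambda> s P Q \<le> upper \<omega> \<and> lower \<omega> \<le> \<Delta>"
proof
  assume *: "\<forall>\<gamma>\<in>{0..1}. csd_gap \<Lambda> s \<gamma> P Q \<le> gap \<omega> \<gamma>"
  show "min_loss \<Lambda> s P Q \<le> upper \<omega> \<and> lower \<omega> \<le> \<Delta>"
    using bspec[OF *, of 0] bspec[OF *, of 1] by (simp add: csd_gap_eq gap_eq)
qed (auto intro: gap_bound)

lemma simultaneous_gap_bound:
  defines "E \<equiv> {\<omega> \<in> space M. \<forall>\<gamma>\<in>{0..1}. csd_gap \<Lambda> s \<gamma> P Q \<le> gap \<omega> \<gamma>}"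
  shows "E \<in> sets M" and "1 - \<delta> \<le> prob E"
proof -
  have E: "E = {\<omega> \<in> space M. min_loss \<Lambda> s P Q \<le> upper \<omega> \<and> lower \<omega> \<le> \<Delta>}"
    unfolding E_def gap_bound_all_iff ..
  show "E \<in> sets M" unfolding E by measurable
  hence "1 - prob E = prob (space M - E)"
    by (simp add: prob_compl)
  also have "\<dots> \<le> prob ({\<omega> \<in> space M. upper \<omega> < min_loss \<Lambda> s P Q} \<union> {\<omega> \<in> space M. \<Delta> < lower \<omega>})"
    by (intro finite_measure_mono) (auto simp: E)
  also have "\<dots> \<le> prob {\<omega> \<in> space M. upper \<omega> < min_loss \<Lambda> s P Q} + prob {\<omega> \<in> space M. \<Delta> < lower \<omega>}"
    by (intro measure_Un_le) auto
  finally show "1 - \<delta> \<le> prob E"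
    using prob_upper_less prob_lower_greater by linarith
qed

text \<open>A vanishing variance term forces both oscillations to be 0; moving first
  \<open>x\<close> to \<open>a0\<close> and then \<open>y\<close> to \<open>b0\<close> leaves the
  loss unchanged.\<close>

lemma loss_constant:
  assumes "\<not> 0 < loss_var"
  obtains l where "\<And>x y. x \<in> A \<Longrightarrow> y \<in> B \<Longrightarrow> \<l> x y = l"
proof -
  have "loss_var = 0"
    using assms by (intro antisym) (auto simp: not_less)
  hence "(loss_osc_P \<Lambda> s A B)\<^sup>2 / m = 0 \<and> (loss_osc_Q \<Lambda> s A B)\<^sup>2 / n = 0"
    by (subst (asm) add_nonneg_eq_0_iff) auto
  hence osc: "loss_osc_P \<Lambda> s A B = 0" "loss_osc_Q \<Lambda> s A B = 0" using m n by auto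
  obtain a0 b0 where a0: "a0 \<in> A" and b0: "b0 \<in> B"
    using P_A Q_B by fastforce
  have "\<l> x y = \<l> a0 b0" if "x \<in> A" "y \<in> B" for x y
    using loss_osc_A[OF that(1) a0 that(2)] loss_osc_B[OF a0 that(2) b0] by (simp add: osc)
  thus ?thesis by (rule that)
qed

text \<open>No minimizing coupling is needed: off an event of probability at most \<open>\<delta>\<close> the bound on the
  minimal loss is strict, unless the loss is constant and every coupling is minimizing.\<close>

lemma false_csd_bound:
  assumes g [measurable]: "g \<in> borel_measurable M" and range: "\<And>\<omega>. \<omega> \<in> space M \<Longrightarrow> g \<omega> \<in> {0..1}"
  defines "F \<equiv> {\<omega> \<in> space M. gap \<omega> (g \<omega>) \<le> 0 \<and> \<not> csd \<Lambda> s (g \<omega>) P Q}"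
  shows "F \<in> sets M" and "prob F \<le> \<delta>"
proof -
  note [measurable] = csd_measurable
  have "F = {\<omega> \<in> space M. gap \<omega> (g \<omega>) \<le> 0 \<and> g \<omega> \<notin> {\<gamma>. csd \<Lambda> s \<gamma> P Q}}"
    by (simp add: F_def)
  also have "\<dots> \<in> sets M" unfolding gap_eq by measurable
  finally show "F \<in> sets M" .
  \<comment> \<open>Equality is excluded exactly when the tail bound permits it. In either case the
    event has probability at most \<open>\<delta> / 2\<close>.\<close>
  define G where "G = {\<omega> \<in> space M.
    if 0 < loss_var then upper \<omega> \<le> min_loss \<Lambda> s P Q else upper \<omega> < min_loss \<Lambda> s P Q}"
  have G: "G \<in> sets M" "prob G \<le> \<delta> / 2"
    unfolding G_def using prob_upper_less prob_upper_le by (cases "0 < loss_var"; simp)+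
  have "F \<subseteq> G \<union> {\<omega> \<in> space M. \<Delta> < lower \<omega>}"
  proof
    fix \<omega> assume \<omega>: "\<omega> \<in> F"
    show "\<omega> \<in> G \<union> {\<omega> \<in> space M. \<Delta> < lower \<omega>}"
    proof (rule ccontr)
      assume not: "\<omega> \<notin> G \<union> {\<omega> \<in> space M. \<Delta> < lower \<omega>}"
      have sp: "\<omega> \<in> space M" and neg: "gap \<omega> (g \<omega>) \<le> 0" and no: "\<not> csd \<Lambda> s (g \<omega>) P Q"
        using \<omega> by (auto simp: F_def)
      have up: "min_loss \<Lambda> s P Q \<le> upper \<omega>" and low: "lower \<omega> \<le> \<Delta>"
        using not sp by (auto simp: G_def split: if_splits)
      have le0: "csd_gap \<Lambda> s (g \<omega>) P Q \<le> 0"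
        using gap_bound[OF range[OF sp] up low] neg by linarith
      show False
      proof (cases "0 < loss_var")
        case True
        have strict: "min_loss \<Lambda> s P Q < upper \<omega>"
          using not sp True by (auto simp: G_def)
        \<comment> \<open>The strict loss bound is multiplied by \<open>1 - g \<omega>\<close>,
          which must be positive for strictness to survive; at the value 1 \<open>csd_1\<close>
          already gives a witness.\<close>
        have g1: "g \<omega> \<noteq> 1" using le0 no csd_1 by auto
        have "(1 - g \<omega>) * min_loss \<Lambda> s P Q < (1 - g \<omega>) * upper \<omega>"
          using strict g1 range[OF sp] by (intro mult_strict_left_mono) auto
        moreover have "g \<omega> * lower \<omega> \<le> g \<omega> * \<Delta>"
          using low range[OF sp] by (intro mult_left_mono) auto
        ultimately have "csd_gap \<Lambda> s (g \<omega>) P Q < 0"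
          using neg unfolding csd_gap_eq[OF range[OF sp]] gap_eq by linarith
        with csd_if_gap_negative[OF range[OF sp]] no show False by blast
      next
        case False
        from loss_constant[OF this] obtain l where "\<And>x y. x \<in> A \<Longrightarrow> y \<in> B \<Longrightarrow> \<l> x y = l" by blast
        with csd_if_loss_constant[OF range[OF sp] le0 AE_P AE_Q] no show False by blast
      qed
    qed
  qed
  hence "prob F \<le> prob (G \<union> {\<omega> \<in> space M. \<Delta> < lower \<omega>})"
    using G(1) by (intro finite_measure_mono) auto
  also have "\<dots> \<le> prob G + prob {\<omega> \<in> space M. \<Delta> < lower \<omega>}"
    using G(1) by (intro measure_Un_le) auto
  finally show "prob F \<le> \<delta>" using G(2) prob_lower_greater by linarith
qed

end

theorem proposition4p1:
  fixes D DP DQ :: "(real ^ 'd) set"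
    and P Q :: "(real ^ 'd) measure"
    and \<Lambda> :: "'t measure"
    and s :: "'t \<Rightarrow> real ^ 'd \<Rightarrow> real"
    and L \<delta> :: real
    and M :: "'w measure"
    and NP NQ :: nat
    and X Y :: "nat \<Rightarrow> 'w \<Rightarrow> real ^ 'd"
  assumes "D \<in> sets borel" and "D \<noteq> {}"
    and "prob_space P" and "sets P = sets borel" and "measure P D = 1"
    and "integrable P (\<lambda>x. norm x)"
    and "prob_space Q" and "sets Q = sets borel" and "measure Q D = 1"
    and "integrable Q (\<lambda>x. norm x)"
    and "DP \<in> sets borel" and "DP \<subseteq> D" and "measure P DP = 1"
    and "DQ \<in> sets borel" and "DQ \<subseteq> D" and "measure Q DQ = 1"
    and "finite_measure \<Lambda>"
    and "(\<lambda>(\<theta>, x). s \<theta> x) \<in> borel_measurable (\<Lambda> \<Otimes>\<^sub>M borel)"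
    and "\<And>\<theta>. \<theta> \<in> space \<Lambda> \<Longrightarrow> mono (s \<theta>)"
    and "(\<integral>\<^sup>+\<theta>. ennreal \<bar>s \<theta> 0\<bar> \<partial>\<Lambda>) < \<infinity>"
    and "0 \<le> L"
    and "\<And>x y. (\<integral>\<^sup>+\<theta>. ennreal \<bar>s \<theta> x - s \<theta> y\<bar> \<partial>\<Lambda>) \<le> ennreal (L * l1_dist x y)"
    and "bdd_above ((\<lambda>(x, x', y). \<bar>loss \<Lambda> s x y - loss \<Lambda> s x' y\<bar>) ` (DP \<times> DP \<times> DQ))"
    and "bdd_above ((\<lambda>(x, y, y'). \<bar>loss \<Lambda> s x y - loss \<Lambda> s x y'\<bar>) ` (DP \<times> DQ \<times> DQ))"
    and "bdd_above ((\<lambda>(x, x'). \<bar>mean_score \<Lambda> s x - mean_score \<Lambda> s x'\<bar>) ` (DP \<times> DP))"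
    and "bdd_above ((\<lambda>(y, y'). \<bar>mean_score \<Lambda> s y - mean_score \<Lambda> s y'\<bar>) ` (DQ \<times> DQ))"
    and "prob_space M" and "0 < NP" and "0 < NQ"
    and "prob_space.indep_vars M (\<lambda>_. borel) X {..<NP}"
    and "\<And>i. i < NP \<Longrightarrow> distr M borel (X i) = P"
    and "prob_space.indep_vars M (\<lambda>_. borel) Y {..<NQ}"
    and "\<And>j. j < NQ \<Longrightarrow> distr M borel (Y j) = Q"
    and "prob_space.indep_var M
           (\<Pi>\<^sub>M i\<in>{..<NP}. borel) (\<lambda>\<omega>. \<lambda>i\<in>{..<NP}. X i \<omega>)
           (\<Pi>\<^sub>M j\<in>{..<NQ}. borel) (\<lambda>\<omega>. \<lambda>j\<in>{..<NQ}. Y j \<omega>)"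
    and "0 < \<delta>" and "\<delta> < 1"
  shows "(let E = {\<omega> \<in> space M. \<forall>\<gamma>\<in>{0..1}.
                csd_gap \<Lambda> s \<gamma> P Q
                  \<le> gap_upper \<Lambda> s DP DQ \<delta> NP NQ (\<lambda>i. X i \<omega>) (\<lambda>j. Y j \<omega>) \<gamma>}
          in E \<in> sets M \<and> measure M E \<ge> 1 - \<delta>)
       \<and> (\<forall>g \<in> borel_measurable ((\<Pi>\<^sub>M i\<in>{..<NP}. borel) \<Otimes>\<^sub>M (\<Pi>\<^sub>M j\<in>{..<NQ}. borel)).
            let \<gamma>h = (\<lambda>\<omega>. g (\<lambda>i\<in>{..<NP}. X i \<omega>, \<lambda>j\<in>{..<NQ}. Y j \<omega>) :: real);
                F = {\<omega> \<in> space M.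
                   gap_upper \<Lambda> s DP DQ \<delta> NP NQ (\<lambda>i. X i \<omega>) (\<lambda>j. Y j \<omega>) (\<gamma>h \<omega>) \<le> 0
                   \<and> \<not> csd \<Lambda> s (\<gamma>h \<omega>) P Q}
            in (\<forall>\<omega>\<in>space M. \<gamma>h \<omega> \<in> {0..1}) \<longrightarrow> F \<in> sets M \<and> measure M F \<le> \<delta>)"
proof -
  have "lipschitz_score \<Lambda> s L"
    by (rule lipschitz_score.intro) fact+
  then have "score_problem \<Lambda> s L P Q"
    using assms(3,4,6,7,8,10) by (intro score_problem.intro score_problem_axioms.intro) auto
  have "two_samples M P Q DP DQ NP NQ X Y"
    by (intro two_samples.intro two_samples_axioms.intro) fact+
  interpret score_samples \<Lambda> s L P Q M DP DQ NP NQ X Y \<delta>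
    by (intro score_samples.intro score_samples_axioms.intro) fact+
  \<comment> \<open>A choice of \<gamma> computed from the data is a random variable on
    \<open>M\<close>, the form in which \<open>false_csd_bound\<close> accepts it.\<close>
  have "(\<lambda>\<omega>. g (\<lambda>i\<in>{..<NP}. X i \<omega>, \<lambda>j\<in>{..<NQ}. Y j \<omega>)) \<in> borel_measurable M"
    if "g \<in> borel_measurable sample_space" for g :: "_ \<Rightarrow> real"
    using measurable_compose[OF sample_measurable that] by (simp add: sample_def)
  then show ?thesis
    using simultaneous_gap_bound false_csd_bound unfolding Let_def by blast
qed

end
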